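(* Let $\mathcal M=(U(1)\times SO(4))\backslash\mathcal S$ be the real moduli space of noncommutative $3$-spheres. (1) Let $N$ be the normalizer of $SO(4)$ in $SU(4)$. Then one has a canonical isomorphism $$\mathcal M\simeq SO(4)\backslash SU(4)/N .$$ (2) Let $\mathbb T\subset SU(4)$ be the maximal torus of diagonal matrices, $W\subset\mathrm{Aut}(\mathbb T)$ the corresponding Weyl group and $D=\mathbb T\cap N$. Then the canonical isomorphism $\mathcal M\simeq SO(4)\backslash SU(4)/N$ restricts (via the inclusion $\mathbb T\subset SU(4)$) to an isomorphism $$\mathcal M\simeq W\backslash\mathbb T/D .$$ (3) The map $u\mapsto u^2$ from $\mathbb T$ to $\mathbb T$ induces an isomorphism $$\mathcal M\simeq W\backslash\mathbb T/D\simeq\text{Space of conjugacy classes in }PSU(4).$$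
   Context: $\mathcal S=\{\Lambda\in M_4(\mathbb C):\Lambda\Lambda^*=\Lambda^*\Lambda=1,\ \Lambda^t=\Lambda\}$; $\lambda\in U(1)$ acts on $\mathcal S$ by $\Lambda\mapsto\lambda^2\Lambda$ and $V\in SO(4)$ by $\Lambda\mapsto V\Lambda V^t$. These are restrictions of the transitive action $\Lambda\mapsto V\Lambda V^t$ of $U(4)$ on $\mathcal S$, and the canonical isomorphism $\mathcal M\simeq SO(4)\backslash SU(4)/N$ is the one induced by $u\in SU(4)\mapsto uu^t\in\mathcal S$. $PSU(4)$ is the quotient of $SU(4)$ by its center. *)

theory Defs
  imports "HOL-Analysis.Analysis" "HOL-Algebra.Group_Action"
begin

text \<open>The points of a quotient space are the values of the projection \<open>p\<close>, which below is always
  a map sending a point to its class.\<close>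

definition quotient_topology :: "'a topology \<Rightarrow> ('a \<Rightarrow> 'b) \<Rightarrow> 'b topology" where
  "quotient_topology X p =
     topology (\<lambda>U. U \<subseteq> p ` topspace X \<and> openin X {x \<in> topspace X. p x \<in> U})"

lemma openin_quotient_topology:
  "openin (quotient_topology X p) U \<longleftrightarrow>
     U \<subseteq> p ` topspace X \<and> openin X {x \<in> topspace X. p x \<in> U}"
proof -
  have "istopology (\<lambda>U. U \<subseteq> p ` topspace X \<and> openin X {x \<in> topspace X. p x \<in> U})"
    unfolding istopology_def
  proof (rule conjI; intro allI impI)
    fix S T
    assume "S \<subseteq> p ` topspace X \<and> openin X {x \<in> topspace X. p x \<in> S}"
      and "T \<subseteq> p ` topspace X \<and> openin X {x \<in> topspace X. p x \<in> T}"
    moreover have "{x \<in> topspace X. p x \<in> S \<inter> T} =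
        {x \<in> topspace X. p x \<in> S} \<inter> {x \<in> topspace X. p x \<in> T}"
      by auto
    ultimately show "S \<inter> T \<subseteq> p ` topspace X \<and> openin X {x \<in> topspace X. p x \<in> S \<inter> T}"
      by (auto intro: openin_Int)
  next
    fix K
    assume "\<forall>S\<in>K. S \<subseteq> p ` topspace X \<and> openin X {x \<in> topspace X. p x \<in> S}"
    moreover have "{x \<in> topspace X. p x \<in> \<Union>K} = (\<Union>S\<in>K. {x \<in> topspace X. p x \<in> S})"
      by auto
    ultimately show "\<Union>K \<subseteq> p ` topspace X \<and> openin X {x \<in> topspace X. p x \<in> \<Union>K}"
      by (auto intro: openin_Union)
  qed
  then show ?thesis
    by (simp add: quotient_topology_def)
qed

lemma topspace_quotient_topology: "topspace (quotient_topology X p) = p ` topspace X"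
proof
  show "topspace (quotient_topology X p) \<subseteq> p ` topspace X"
    using openin_quotient_topology[of X p "topspace (quotient_topology X p)"] by auto
  have "{x \<in> topspace X. p x \<in> p ` topspace X} = topspace X"
    by auto
  then have "openin (quotient_topology X p) (p ` topspace X)"
    by (simp add: openin_quotient_topology)
  then show "p ` topspace X \<subseteq> topspace (quotient_topology X p)"
    by (rule openin_subset)
qed

lemma quotient_map_quotient_topology: "quotient_map X (quotient_topology X p) p"
  by (auto simp: quotient_map_def topspace_quotient_topology openin_quotient_topology)

definition conj_transpose :: "complex^4^4 \<Rightarrow> complex^4^4" where
  "conj_transpose A = map_matrix cnj (transpose A)"

definition unitary :: "complex^4^4 \<Rightarrow> bool" where
  "unitary A \<longleftrightarrow> A ** conj_transpose A = mat 1 \<and> conj_transpose A ** A = mat 1"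

definition SU4 :: "(complex^4^4) monoid" where
  "SU4 = \<lparr>carrier = {A. unitary A \<and> det A = 1}, mult = (**), one = mat 1\<rparr>"

definition SO4 :: "(complex^4^4) set" where
  "SO4 = map_matrix complex_of_real ` {Q :: real^4^4. rotation_matrix Q}"

definition U1 :: "complex monoid" where
  "U1 = \<lparr>carrier = {c. cmod c = 1}, mult = (*), one = 1\<rparr>"

definition SU4_top :: "(complex^4^4) topology" where
  "SU4_top = top_of_set (carrier SU4)"

definition sym_unitary :: "(complex^4^4) set" where
  "sym_unitary = {L. unitary L \<and> transpose L = L}"

definition moduli_action :: "complex \<times> (complex^4^4) \<Rightarrow> complex^4^4 \<Rightarrow> complex^4^4" where
  "moduli_action = (\<lambda>(c, V) L. mat (c\<^sup>2) ** (V ** L ** transpose V))"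

definition moduli_class :: "complex^4^4 \<Rightarrow> (complex^4^4) set" where
  "moduli_class = orbit (U1 \<times>\<times> SU4\<lparr>carrier := SO4\<rparr>) moduli_action"

definition moduli_space :: "(complex^4^4) set topology" where
  "moduli_space = quotient_topology (top_of_set sym_unitary) moduli_class"

definition N4 :: "(complex^4^4) set" where
  "N4 = normalizer SU4 SO4"

definition double_coset :: "complex^4^4 \<Rightarrow> (complex^4^4) set" where
  "double_coset u = SO4 <#>\<^bsub>SU4\<^esub> (u <#\<^bsub>SU4\<^esub> N4)"

definition double_coset_space :: "(complex^4^4) set topology" where
  "double_coset_space = quotient_topology SU4_top double_coset"

definition torus :: "(complex^4^4) set" where
  "torus = {u \<in> carrier SU4. \<forall>i j. i \<noteq> j \<longrightarrow> u $ i $ j = 0}"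

text \<open>The normalizer of the torus modulo its centralizer, realized as a set of automorphisms of
  the torus.\<close>

definition weyl :: "(complex^4^4 \<Rightarrow> complex^4^4) set" where
  "weyl = {\<lambda>t\<in>torus. g \<otimes>\<^bsub>SU4\<^esub> t \<otimes>\<^bsub>SU4\<^esub> inv\<^bsub>SU4\<^esub> g | g. g \<in> normalizer SU4 torus}"

definition D4 :: "(complex^4^4) set" where
  "D4 = torus \<inter> N4"

definition torus_class :: "complex^4^4 \<Rightarrow> (complex^4^4) set" where
  "torus_class t = {w t \<otimes>\<^bsub>SU4\<^esub> d | w d. w \<in> weyl \<and> d \<in> D4}"

definition torus_quotient :: "(complex^4^4) set topology" where
  "torus_quotient = quotient_topology (top_of_set torus) torus_class"

definition center_SU4 :: "(complex^4^4) set" where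
  "center_SU4 = {z \<in> carrier SU4. \<forall>g \<in> carrier SU4. z \<otimes>\<^bsub>SU4\<^esub> g = g \<otimes>\<^bsub>SU4\<^esub> z}"

definition PSU4 :: "(complex^4^4) set monoid" where
  "PSU4 = SU4 Mod center_SU4"

definition to_PSU4 :: "complex^4^4 \<Rightarrow> (complex^4^4) set" where
  "to_PSU4 u = center_SU4 #>\<^bsub>SU4\<^esub> u"

definition PSU4_top :: "(complex^4^4) set topology" where
  "PSU4_top = quotient_topology SU4_top to_PSU4"

definition conj_class :: "(complex^4^4) set \<Rightarrow> (complex^4^4) set set" where
  "conj_class = orbit PSU4 (\<lambda>g x. g \<otimes>\<^bsub>PSU4\<^esub> x \<otimes>\<^bsub>PSU4\<^esub> inv\<^bsub>PSU4\<^esub> g)"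

definition conj_class_space :: "(complex^4^4) set set topology" where
  "conj_class_space = quotient_topology PSU4_top conj_class"

end

theory Submission
  imports Defs
begin

text \<open>Everything is read off the symmetric unitary matrix \<open>u u\<^sup>t\<close>. For \<open>u\<close> in \<open>SU(4)\<close>, \<open>u\<close> is in
  \<open>SO(4)\<close> iff \<open>u u\<^sup>t = 1\<close> and in \<open>N\<close> iff \<open>u u\<^sup>t\<close> is scalar, because only scalars commute with \<open>SO(4)\<close>.
  Hence \<open>u\<close> and \<open>v\<close> have the same double coset iff \<open>u u\<^sup>t\<close> is a unit scalar times an
  \<open>SO(4)\<close>-conjugate of \<open>v v\<^sup>t\<close>. Symmetric unitary matrices are diagonalized by \<open>SO(4)\<close>, so every
  double coset meets the torus. For \<open>t\<close> and \<open>t'\<close> in the torus, equality of the classes under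
  \<open>W\<close> and \<open>D\<close> implies equality of the double cosets, which implies that the squares are conjugate in
  \<open>PSU(4)\<close>; this gives back the first relation, since similar diagonal matrices differ by a
  permutation, which a signed permutation matrix in \<open>SO(4)\<close> realizes. The bijections are
  homeomorphisms because each comes from a continuous map from a compact space to a space on which
  a compact group acts.\<close>

section \<open>Quotients by compact group actions\<close>

text \<open>Turns the two successive projections behind the conjugacy classes of PSU(4) into one
  projection from SU(4), so that the next lemma applies with matrices as representatives.\<close>

lemma quotient_topology_quotient_topology:
  "quotient_topology (quotient_topology X p) q = quotient_topology X (q \<circ> p)"
proof -
  have "{x \<in> topspace X. p x \<in> {y \<in> p ` topspace X. q y \<in> U}} = {x \<in> topspace X. (q \<circ> p) x \<in> U}" for U
    by auto
  then show ?thesis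
    by (auto simp: topology_eq openin_quotient_topology topspace_quotient_topology image_comp)
qed

text \<open>\<open>K\<close> and \<open>a\<close> parametrize the fibres of \<open>q\<close>. The
  saturation of a closed set coming from \<open>S\<close> is cut out of \<open>T\<close> by the
  image of a compact set under \<open>a\<close>, hence closed in \<open>T\<close>. So
  \<open>q \<circ> f\<close> is a quotient map, and \<open>eq\<close> says that its fibres are those
  of \<open>p\<close>.\<close>

lemma homeomorphic_quotient_topologies:
  fixes f :: "'a::topological_space \<Rightarrow> 'b::t2_space" and a :: "'k::topological_space \<Rightarrow> 'b \<Rightarrow> 'b"
  assumes S: "compact S" and K: "compact K"
    and f: "continuous_on S f" and fS: "f ` S \<subseteq> T"
    and a: "continuous_on (K \<times> T) (\<lambda>(k, y). a k y)"
    and eq: "\<And>x x'. x \<in> S \<Longrightarrow> x' \<in> S \<Longrightarrow> p x = p x' \<longleftrightarrow> q (f x) = q (f x')"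
    and surj: "\<And>y. y \<in> T \<Longrightarrow> \<exists>x\<in>S. q y = q (f x)"
    and act: "\<And>y y'. y \<in> T \<Longrightarrow> y' \<in> T \<Longrightarrow> q y = q y' \<longleftrightarrow> (\<exists>k\<in>K. y = a k y')"
  shows "\<exists>h. homeomorphic_map (quotient_topology (top_of_set S) p) (quotient_topology (top_of_set T) q) h \<and>
           (\<forall>x\<in>S. h (p x) = q (f x))"
proof -
  let ?P = "quotient_topology (top_of_set S) p" and ?Q = "quotient_topology (top_of_set T) q"
  have qf: "quotient_map (top_of_set S) ?Q (q \<circ> f)"
    unfolding quotient_map_closedin
  proof (intro conjI allI impI)
    show "(q \<circ> f) ` topspace (top_of_set S) = topspace ?Q"
      using fS surj by (fastforce simp: topspace_quotient_topology)
    fix U assume U: "U \<subseteq> topspace ?Q"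
    have cont: "continuous_map (top_of_set S) ?Q (q \<circ> f)"
    proof (rule continuous_map_compose)
      show "continuous_map (top_of_set S) (top_of_set T) f"
        using f fS by (auto simp: image_subset_iff_funcset)
      show "continuous_map (top_of_set T) ?Q q"
        by (rule quotient_imp_continuous_map[OF quotient_map_quotient_topology])
    qed
    show "closedin (top_of_set S) {x \<in> topspace (top_of_set S). (q \<circ> f) x \<in> U} = closedin ?Q U"
    proof
      assume "closedin ?Q U"
      then show "closedin (top_of_set S) {x \<in> topspace (top_of_set S). (q \<circ> f) x \<in> U}"
        by (rule closedin_continuous_map_preimage[OF cont])
    next
      define C where "C = {x \<in> S. (q \<circ> f) x \<in> U}"
      assume "closedin (top_of_set S) {x \<in> topspace (top_of_set S). (q \<circ> f) x \<in> U}"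
      then have "compact C"
        using S closedin_compact by (auto simp: C_def)
      then have "compact (f ` C)"
        by (intro compact_continuous_image continuous_on_subset[OF f]) (auto simp: C_def)
      moreover have "f ` C \<subseteq> T" using fS by (auto simp: C_def)
      ultimately have "compact ((\<lambda>(k, y). a k y) ` (K \<times> f ` C))"
        using K by (intro compact_continuous_image[OF _ compact_Times] continuous_on_subset[OF a]) (use \<open>compact (f ` C)\<close> \<open>f ` C \<subseteq> T\<close> in auto)
      \<comment> \<open>The preimage of \<open>U\<close> is the saturation of the image of
        \<open>C\<close>: \<open>surj\<close> relates each of its points to a value of
        \<open>f\<close>, and \<open>act\<close> then supplies \<open>k\<close>.\<close>
      moreover have "{y \<in> T. q y \<in> U} = T \<inter> (\<lambda>(k, y). a k y) ` (K \<times> f ` C)"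
      proof (rule equalityI; rule subsetI)
        fix y assume "y \<in> {y \<in> T. q y \<in> U}"
        then have y: "y \<in> T" "q y \<in> U" by auto
        then obtain x where x: "x \<in> S" "q y = q (f x)" using surj by blast
        then obtain k where "k \<in> K" "y = a k (f x)" using act[OF y(1), of "f x"] fS by auto
        then show "y \<in> T \<inter> (\<lambda>(k, y). a k y) ` (K \<times> f ` C)"
          using x y by (force simp: C_def)
      next
        fix y assume "y \<in> T \<inter> (\<lambda>(k, y). a k y) ` (K \<times> f ` C)"
        then obtain k x where *: "y \<in> T" "k \<in> K" "x \<in> C" "y = a k (f x)" by auto
        then have "q y = q (f x)" using act[of y "f x"] fS by (auto simp: C_def)
        then show "y \<in> {y \<in> T. q y \<in> U}" using * by (auto simp: C_def)
      qed
      ultimately have "closedin (top_of_set T) {y \<in> T. q y \<in> U}"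
        by (metis closedin_closed_Int compact_imp_closed)
      then show "closedin ?Q U"
        using quotient_map_quotient_topology[of "top_of_set T" q] U
        by (auto simp: quotient_map_closedin)
    qed
  qed
  \<comment> \<open>The map that \<open>q \<circ> f\<close> induces on classes; the arbitrary
    representative is harmless by \<open>eq\<close>.\<close>
  define h where "h c = q (f (SOME x. x \<in> S \<and> p x = c))" for c
  have h: "h (p x) = q (f x)" if "x \<in> S" for x
  proof -
    have "\<exists>x'. x' \<in> S \<and> p x' = p x" using that by blast
    from someI_ex[OF this] show ?thesis using that eq by (auto simp: h_def)
  qed
  have "quotient_map (top_of_set S) ?Q (h \<circ> p)"
    by (rule quotient_map_eq[OF qf]) (auto simp: h)
  then have "quotient_map ?P ?Q h"
    by (simp add: quotient_map_compose_eq[OF quotient_map_quotient_topology])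
  moreover have "inj_on h (topspace ?P)"
    by (auto simp: topspace_quotient_topology inj_on_def h eq)
  ultimately show ?thesis
    using h by (auto simp: homeomorphic_map_def)
qed

section \<open>Diagonalization of unitary matrices\<close>

text \<open>A maximizer of the Rayleigh quotient on the unit sphere of \<open>W\<close>, which
  exists by compactness, is an eigenvector. Working over the reals makes this usable on real
  subspaces of a complex vector space.\<close>

lemma selfadjoint_eigenvector:
  fixes f :: "'a::euclidean_space \<Rightarrow> 'a"
  assumes W: "subspace W" "x0 \<in> W" "x0 \<noteq> 0" and f: "linear f" "f ` W \<subseteq> W"
    and sa: "\<And>x y. f x \<bullet> y = x \<bullet> f y"
  shows "\<exists>x\<in>W. \<exists>c. norm x = 1 \<and> f x = c *\<^sub>R x"
proof -
  let ?S = "W \<inter> sphere 0 1"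
  have "x0 /\<^sub>R norm x0 \<in> ?S"
    using W by (auto simp: subspace_scale)
  then have "?S \<noteq> {}" by blast
  moreover have "compact ?S"
    using W(1) by (intro closed_Int_compact closed_subspace) auto
  moreover have "continuous_on ?S (\<lambda>x. x \<bullet> f x)"
    using f(1) by (intro continuous_intros linear_continuous_on linear_conv_bounded_linear[THEN iffD1])
  ultimately obtain x where x: "x \<in> ?S" "\<And>y. y \<in> ?S \<Longrightarrow> y \<bullet> f y \<le> x \<bullet> f x"
    using continuous_attains_sup[of ?S "\<lambda>x. x \<bullet> f x"] by blast
  define c where "c = x \<bullet> f x"
  \<comment> \<open>\<open>g\<close> is positive semidefinite on \<open>W\<close> and \<open>x \<bullet> g x = 0\<close>, which forces \<open>g x = 0\<close>.\<close>
  define g where "g y = c *\<^sub>R y - f y" for y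
  have xx: "x \<bullet> x = 1" "x \<in> W" using x(1) by (auto simp: norm_eq_1)
  have g_lin: "linear g" unfolding g_def
    using f(1) by (intro linear_compose_sub linear_scaleR)
  have g_sa: "g x \<bullet> y = x \<bullet> g y" for x y
    using sa by (simp add: g_def algebra_simps)
  have g_pos: "0 \<le> y \<bullet> g y" if "y \<in> W" for y
  proof (cases "y = 0")
    case False
    then have "y /\<^sub>R norm y \<in> ?S" using that W(1) by (auto simp: subspace_scale)
    from x(2)[OF this] have "(y \<bullet> f y) / (norm y)\<^sup>2 \<le> c"
      using linear_scale[OF f(1)] by (simp add: c_def power2_eq_square divide_inverse mult.assoc mult.commute mult.left_commute)
    then have "y \<bullet> f y \<le> c * (y \<bullet> y)"
      using False by (simp add: divide_le_eq power2_norm_eq_inner)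
    then show ?thesis by (simp add: g_def algebra_simps)
  qed simp
  have gx: "x \<bullet> g x = 0" by (simp add: g_def c_def algebra_simps xx)
  have gW: "g x \<in> W" using xx f(2) W(1) by (auto simp: g_def subspace_diff subspace_scale)
  define s where "s = g x \<bullet> g x"
  define m where "m = g x \<bullet> g (g x)"
  have "m \<ge> 0" using g_pos[OF gW] by (simp add: m_def)
  \<comment> \<open>Chosen to make the quadratic below negative unless \<open>s = 0\<close>; the
    \<open>+ 1\<close> keeps the denominator positive when \<open>m = 0\<close>.\<close>
  define t where "t = - (s / (m + 1))"
  have "0 \<le> (x + t *\<^sub>R g x) \<bullet> g (x + t *\<^sub>R g x)"
    using g_pos gW xx W(1) by (auto simp: subspace_add subspace_scale)
  also have "\<dots> = 2 * t * s + t\<^sup>2 * m"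
    using gx g_sa[of x "g x"] by (simp add: linear_add[OF g_lin] linear_scale[OF g_lin] algebra_simps s_def m_def power2_eq_square inner_commute)
  finally have "0 \<le> 2 * t * s + t\<^sup>2 * m" .
  moreover have "2 * t * s + t\<^sup>2 * m = - (s\<^sup>2 * (m + 2) / (m + 1)\<^sup>2)"
    using \<open>m \<ge> 0\<close> by (simp add: t_def divide_simps) (simp add: algebra_simps power2_eq_square)
  ultimately have "s\<^sup>2 * (m + 2) / (m + 1)\<^sup>2 \<le> 0" by simp
  then have "s = 0" using \<open>m \<ge> 0\<close> by (simp add: divide_le_0_iff mult_le_0_iff)
  then have "g x = 0" by (simp add: s_def)
  then have "f x = c *\<^sub>R x" by (simp add: g_def)
  then show ?thesis using x(1) by auto
qed

lemma mat_matrix_mult_nth [simp]: "(mat c ** A) $ i $ j = c * (A $ i $ j :: 'a::comm_semiring_1)"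
  by (simp add: mat_def matrix_matrix_mult_def if_distrib[of "\<lambda>x. x * _"] cong: if_cong)

lemma mat_vector_mult: "mat c *v (x :: 'a::comm_semiring_1^'n) = c *s x"
  by (simp add: mat_def matrix_vector_mult_def vec_eq_iff if_distrib[of "\<lambda>x. x * _"] cong: if_cong)

lemma conj_transpose_nth [simp]: "conj_transpose A $ i $ j = cnj (A $ j $ i)"
  by (simp add: conj_transpose_def transpose_def)

text \<open>The Euclidean inner product on complex vectors is the real part of the Hermitian form,
  so real self-adjointness can be read off the conjugate transpose.\<close>

lemma inner_conj_transpose: "(A *v x) \<bullet> y = x \<bullet> (conj_transpose A *v y)"
proof -
  have inner: "a \<bullet> b = Re (a * cnj b)" for a b :: complex
    by (simp add: inner_complex_def)
  have "(A *v x) \<bullet> y = Re (\<Sum>i\<in>UNIV. \<Sum>j\<in>UNIV. A $ i $ j * x $ j * cnj (y $ i))"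
    by (simp add: inner_vec_def matrix_vector_mult_def inner sum_distrib_right flip: Re_sum)
  also have "\<dots> = Re (\<Sum>j\<in>UNIV. \<Sum>i\<in>UNIV. A $ i $ j * x $ j * cnj (y $ i))"
    by (subst sum.swap) simp
  also have "\<dots> = x \<bullet> (conj_transpose A *v y)"
    by (simp add: inner_vec_def matrix_vector_mult_def inner sum_distrib_left mult_ac flip: Re_sum)
  finally show ?thesis .
qed

lemma linear_matrix_vector_complex: "linear ((*v) (A :: complex^'n^'m))"
  by (auto intro!: linearI simp: matrix_vector_right_distrib vec_eq_iff matrix_vector_mult_def
      sum.distrib algebra_simps scaleR_sum_right)

lemma conj_transpose_mult: "conj_transpose (A ** B) = conj_transpose B ** conj_transpose A"
  by (simp add: vec_eq_iff matrix_matrix_mult_def mult.commute)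

lemma conj_transpose_conj_transpose [simp]: "conj_transpose (conj_transpose A) = A"
  by (simp add: vec_eq_iff)

text \<open>\<open>W\<close> is only a real subspace, so invariance is asked of two self-adjoint
  combinations of \<open>u\<close> and not of \<open>u\<close> itself: for symmetric
  \<open>u\<close> these are real matrices and preserve the real vectors, while \<open>u\<close>
  need not.\<close>

lemma unitary_eigenvector:
  assumes u: "unitary u" and W: "subspace W" "x0 \<in> W" "x0 \<noteq> 0"
    and W1: "\<And>x. x \<in> W \<Longrightarrow> u *v x + conj_transpose u *v x \<in> W"
    and W2: "\<And>x. x \<in> W \<Longrightarrow> \<i> *s (u *v x - conj_transpose u *v x) \<in> W"
  shows "\<exists>x\<in>W. \<exists>c. norm x = 1 \<and> u *v x = c *s x"
proof -
  \<comment> \<open>The Hermitian and anti-Hermitian parts of \<open>u\<close> commute, so they have a common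
    eigenvector in \<open>W\<close>.\<close>
  define f where "f x = u *v x + conj_transpose u *v x" for x
  define g where "g x = \<i> *s (u *v x - conj_transpose u *v x)" for x
  have f_eq: "f x = (u + conj_transpose u) *v x" for x
    by (simp add: f_def matrix_vector_mult_add_rdistrib)
  have g_eq: "g x = (mat \<i> ** (u - conj_transpose u)) *v x" for x
    by (simp add: g_def matrix_vector_mult_diff_rdistrib mat_vector_mult flip: matrix_vector_mul_assoc)
  have ct1: "conj_transpose (u + conj_transpose u) = u + conj_transpose u"
    by (simp add: vec_eq_iff)
  have ct2: "conj_transpose (mat \<i> ** (u - conj_transpose u)) = mat \<i> ** (u - conj_transpose u)"
    by (simp add: vec_eq_iff algebra_simps)
  have uu: "u *v (conj_transpose u *v x) = x" "conj_transpose u *v (u *v x) = x" for x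
    using u by (simp_all add: matrix_vector_mul_assoc unitary_def)
  have "f ` W \<subseteq> W" using W1 by (auto simp: f_def)
  have f_fun: "f = (*v) (u + conj_transpose u)" and g_fun: "g = (*v) (mat \<i> ** (u - conj_transpose u))"
    by (simp_all add: fun_eq_iff f_eq g_eq)
  have lin_f: "linear f" and lin_g: "linear g"
    by (simp_all add: f_fun g_fun linear_matrix_vector_complex)
  have sa_f: "f x \<bullet> y = x \<bullet> f y" and sa_g: "g x \<bullet> y = x \<bullet> g y" for x y
    by (simp_all add: f_fun g_fun inner_conj_transpose ct1 ct2)
  obtain x1 a where x1: "x1 \<in> W" "norm x1 = 1" "f x1 = a *\<^sub>R x1"
    using selfadjoint_eigenvector[OF W lin_f \<open>f ` W \<subseteq> W\<close> sa_f] by blast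
  define W' where "W' = {x\<in>W. f x = a *\<^sub>R x}"
  have W': "subspace W'" "x1 \<in> W'" "x1 \<noteq> 0"
    using W(1) x1 lin_f by (auto simp: W'_def subspace_def linear_add linear_0 linear_scale algebra_simps)
  \<comment> \<open>\<open>f\<close> and \<open>g\<close> commute, both being combinations of
    \<open>u\<close> and its inverse; hence the eigenspace \<open>W'\<close> of \<open>f\<close> is
    stable under \<open>g\<close>.\<close>
  have "f (g x) = a *\<^sub>R g x" if "f x = a *\<^sub>R x" for x
  proof -
    have "f (g x) = \<i> *s (u *v f x - conj_transpose u *v f x)"
      by (simp add: f_def g_def uu vec.scale vec.diff vec.add algebra_simps)
    then show ?thesis
      unfolding that g_def linear_scale[OF linear_matrix_vector_complex]
      by (simp add: vec_eq_iff scaleR_diff_right)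
  qed
  then have "g ` W' \<subseteq> W'" using W2 by (auto simp: W'_def g_def)
  then obtain x b where x: "x \<in> W'" "norm x = 1" "g x = b *\<^sub>R x"
    using selfadjoint_eigenvector[OF W' lin_g _ sa_g] by blast
  have "f x = a *\<^sub>R x" using x by (simp add: W'_def)
  \<comment> \<open>\<open>u\<close> is recovered from its two self-adjoint parts, so their common
    eigenvector is an eigenvector of \<open>u\<close>.\<close>
  have "2 *s (u *v x) = f x - \<i> *s g x"
    by (simp add: f_def g_def vec_eq_iff algebra_simps)
  then have "u *v x = ((of_real a - \<i> * of_real b) / 2) *s x"
    using x(3) \<open>f x = a *\<^sub>R x\<close> by (simp add: vec_eq_iff scaleR_conv_of_real[where 'a = complex] algebra_simps)
  then show ?thesis using x by (auto simp: W'_def)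
qed

text \<open>The Hermitian form, linear in the first argument. The Euclidean inner product is only
  its real part and too weak to express complex orthogonality.\<close>

definition cinner :: "complex^'n \<Rightarrow> complex^'n \<Rightarrow> complex" where
  "cinner x y = (\<Sum>i\<in>UNIV. x $ i * cnj (y $ i))"

lemma cinner_self: "cinner x x = of_real ((norm x)\<^sup>2)"
  by (simp add: cinner_def norm_vec_def L2_set_def sum_nonneg complex_norm_square flip: of_real_power)

lemma cinner_commute: "cinner y x = cnj (cinner x y)"
  by (simp add: cinner_def mult.commute)

lemma cinner_scale [simp]: "cinner (c *s x) y = c * cinner x y" "cinner x (c *s y) = cnj c * cinner x y"
  by (simp_all add: cinner_def sum_distrib_left mult_ac)

lemma cinner_add: "cinner (x + y) z = cinner x z + cinner y z"
  by (simp add: cinner_def sum.distrib algebra_simps)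

lemma cinner_diff: "cinner (x - y) z = cinner x z - cinner y z"
  by (simp add: cinner_def sum_subtractf algebra_simps)

lemma cinner_conj_transpose: "cinner (A *v x) y = cinner x (conj_transpose A *v y)"
proof -
  have "cinner (A *v x) y = (\<Sum>i\<in>UNIV. \<Sum>j\<in>UNIV. A $ i $ j * x $ j * cnj (y $ i))"
    by (simp add: cinner_def matrix_vector_mult_def sum_distrib_right)
  also have "\<dots> = (\<Sum>j\<in>UNIV. \<Sum>i\<in>UNIV. A $ i $ j * x $ j * cnj (y $ i))"
    by (subst sum.swap) simp
  also have "\<dots> = cinner x (conj_transpose A *v y)"
    by (simp add: cinner_def matrix_vector_mult_def sum_distrib_left mult_ac)
  finally show ?thesis .
qed

text \<open>\<open>R\<close> is either the whole space or the real subspace; the latter is what makes the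
  diagonalizing matrix of a symmetric unitary matrix real.\<close>

lemma orthonormal_eigenvectors:
  assumes u: "unitary u" and R: "subspace R"
    and R1: "\<forall>x\<in>R. u *v x + conj_transpose u *v x \<in> R"
    and R2: "\<forall>x\<in>R. \<i> *s (u *v x - conj_transpose u *v x) \<in> R"
    and ex: "\<forall>I v. I \<noteq> UNIV \<longrightarrow> v ` I \<subseteq> R \<longrightarrow>
        (\<exists>x\<in>R. x \<noteq> 0 \<and> (\<forall>i\<in>I. cinner x (v (i :: 4) :: complex^4) = 0))"
  shows "\<exists>v c. \<forall>i\<in>(I::4 set). v i \<in> R \<and> u *v v i = c i *s v i \<and>
      (\<forall>j\<in>I. cinner (v i) (v j) = (if i = j then 1 else 0))"
  using finite[of I]
proof (induction I)
  case empty
  then show ?case by simp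
next
  case (insert k I)
  then obtain v c where v: "\<And>i. i \<in> I \<Longrightarrow> v i \<in> R" "\<And>i. i \<in> I \<Longrightarrow> u *v v i = c i *s v i"
    "\<And>i j. i \<in> I \<Longrightarrow> j \<in> I \<Longrightarrow> cinner (v i) (v j) = (if i = j then 1 else 0)"
    by metis
  \<comment> \<open>The next eigenvector is sought in \<open>R\<close>, orthogonal to those already
    found; \<open>ex\<close> guarantees that this space is nonzero.\<close>
  define W where "W = {x\<in>R. \<forall>i\<in>I. cinner x (v i) = 0}"
  have scale: "r *\<^sub>R x = of_real r *s x" for r and x :: "complex^4"
    by (simp add: vec_eq_iff scaleR_conv_of_real[where 'a = complex])
  have W: "subspace W"
    using R by (auto simp: W_def subspace_def cinner_add scale) (simp add: cinner_def)
  obtain x0 where x0: "x0 \<in> W" "x0 \<noteq> 0"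
    using ex[rule_format, of I v] v(1) insert.hyps by (auto simp: W_def)
  \<comment> \<open>As \<open>u\<close> is unitary, \<open>v i\<close> is also an eigenvector of
    \<open>conj_transpose u\<close>; thus both matrices preserve orthogonality to
    \<open>v i\<close>.\<close>
  have uW: "cinner (u *v x) (v i) = 0 \<and> cinner (conj_transpose u *v x) (v i) = 0" if "x \<in> W" "i \<in> I" for x i
  proof
    have x: "cinner x (v i) = 0" using that by (simp add: W_def)
    have 1: "v i = c i *s (conj_transpose u *v v i)"
      using u v(2)[OF that(2)] by (metis matrix_vector_mul_assoc matrix_vector_mul_lid unitary_def vec.scale)
    have "v i \<noteq> 0" using v(3)[OF that(2) that(2)] by (auto simp: cinner_def)
    then have "c i \<noteq> 0" using 1 by auto
    have "cinner x (v i) = cnj (c i) * cinner (u *v x) (v i)"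
      by (subst 1) (simp add: cinner_conj_transpose)
    then show "cinner (u *v x) (v i) = 0" using x \<open>c i \<noteq> 0\<close> by simp
    show "cinner (conj_transpose u *v x) (v i) = 0"
      using x by (simp add: cinner_conj_transpose v(2)[OF that(2)])
  qed
  have "\<exists>x\<in>W. \<exists>c. norm x = 1 \<and> u *v x = c *s x"
  proof (rule unitary_eigenvector[OF u W x0])
    show "u *v x + conj_transpose u *v x \<in> W" if "x \<in> W" for x
      using uW[OF that] R1 that by (simp add: W_def cinner_add)
    show "\<i> *s (u *v x - conj_transpose u *v x) \<in> W" if "x \<in> W" for x
      using uW[OF that] R2 that by (simp add: W_def cinner_diff)
  qed
  then obtain x d where x: "x \<in> W" "norm x = 1" "u *v x = d *s x" by blast
  then have xI: "cinner x (v i) = 0" "cinner (v i) x = 0" if "i \<in> I" for i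
    using that cinner_commute[of "v i" x] by (auto simp: W_def)
  have "\<forall>i\<in>insert k I. (v(k := x)) i \<in> R \<and> u *v (v(k := x)) i = (c(k := d)) i *s (v(k := x)) i \<and>
      (\<forall>j\<in>insert k I. cinner ((v(k := x)) i) ((v(k := x)) j) = (if i = j then 1 else 0))"
    using x v xI insert.hyps cinner_self[of x] by (auto simp: W_def)
  then show ?case by blast
qed

definition diag_matrix :: "('n \<Rightarrow> 'a::zero) \<Rightarrow> 'a^'n^'n" where
  "diag_matrix d = (\<chi> i j. if i = j then d i else 0)"

lemma unitary_diagonalization_within:
  assumes "unitary u" and "subspace R"
    and "\<forall>x\<in>R. u *v x + conj_transpose u *v x \<in> R"
    and "\<forall>x\<in>R. \<i> *s (u *v x - conj_transpose u *v x) \<in> R"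
    and "\<forall>I v. I \<noteq> UNIV \<longrightarrow> v ` I \<subseteq> R \<longrightarrow>
        (\<exists>x\<in>R. x \<noteq> 0 \<and> (\<forall>i\<in>I. cinner x (v (i :: 4) :: complex^4) = 0))"
  shows "\<exists>P d. unitary P \<and> u ** P = P ** diag_matrix d \<and> (\<forall>j. (\<chi> i. P $ i $ j) \<in> R)"
proof -
  obtain v c where v: "v i \<in> R" "u *v v i = c i *s v i"
    "cinner (v i) (v j) = (if i = j then 1 else 0)" for i j :: 4
    using orthonormal_eigenvectors[OF assms, of UNIV] by auto
  define P where "P = (\<chi> i j. v j $ i)"
  have "(conj_transpose P ** P) $ i $ j = cinner (v j) (v i)" for i j
    by (simp add: P_def matrix_matrix_mult_def cinner_def mult.commute)
  then have "conj_transpose P ** P = mat 1"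
    using v(3) by (auto simp: vec_eq_iff mat_def)
  then have "unitary P"
    by (simp add: unitary_def matrix_left_right_inverse)
  moreover have "u ** P = P ** diag_matrix c"
    using v(2) by (simp add: vec_eq_iff P_def matrix_matrix_mult_def matrix_vector_mult_def diag_matrix_def
       if_distrib[of "\<lambda>x. _ * x"] mult.commute cong: if_cong)
  moreover have "(\<chi> i. P $ i $ j) = v j" for j
    by (simp add: P_def vec_eq_iff)
  ultimately show ?thesis using v(1) by (intro exI[of _ P] exI[of _ c]) simp
qed

text \<open>A square matrix with a zero row is singular. Here the rows indexed by \<open>I\<close>
  are the conjugates of the \<open>v i\<close> and the others vanish, so a kernel vector is
  orthogonal to all these \<open>v i\<close>.\<close>

lemma ex_cinner_orthogonal:
  fixes v :: "'n \<Rightarrow> complex^'n"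
  assumes "I \<noteq> UNIV"
  shows "\<exists>x. x \<noteq> 0 \<and> (\<forall>i\<in>I. cinner x (v i) = 0)"
proof -
  define M :: "complex^'n^'n" where "M = (\<chi> i j. if i \<in> I then cnj (v i $ j) else 0)"
  obtain k where "k \<notin> I" using assms by blast
  have "\<not> (\<exists>B. B ** M = mat 1)"
  proof
    assume "\<exists>B. B ** M = mat 1"
    then obtain B where "M ** B = mat 1" using matrix_left_right_inverse by blast
    then have "(M ** B) $ k $ k = 1" by (simp add: mat_def)
    then show False using \<open>k \<notin> I\<close> by (simp add: M_def matrix_matrix_mult_def)
  qed
  then obtain x where "x \<noteq> 0" "M *v x = 0"
    using matrix_left_invertible_ker by blast
  moreover have "cinner x (v i) = (M *v x) $ i" if "i \<in> I" for i
    using that by (simp add: cinner_def M_def matrix_vector_mult_def mult.commute)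
  ultimately show ?thesis by auto
qed

lemma unitary_diagonalization:
  assumes "unitary u"
  obtains P d where "unitary P" "u ** P = P ** diag_matrix d"
proof -
  have "\<forall>I v. I \<noteq> UNIV \<longrightarrow> v ` I \<subseteq> UNIV \<longrightarrow>
      (\<exists>x\<in>UNIV. x \<noteq> 0 \<and> (\<forall>i\<in>I. cinner x (v (i :: 4) :: complex^4) = 0))"
    by (intro allI impI) (simp add: ex_cinner_orthogonal)
  then have "\<exists>P d. unitary P \<and> u ** P = P ** diag_matrix d \<and> (\<forall>j. (\<chi> i. P $ i $ j) \<in> UNIV)"
    using unitary_diagonalization_within[of u UNIV] assms by simp
  then show ?thesis using that by blast
qed

text \<open>For symmetric \<open>u\<close> the conjugate transpose is the entrywise conjugate, so
  both self-adjoint combinations of \<open>u\<close> are real matrices and the eigenvectors can be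
  sought among the real vectors.\<close>

lemma symmetric_unitary_diagonalization:
  assumes u: "unitary u" "transpose u = u"
  obtains P d where "unitary P" "map_matrix cnj P = P" "u ** P = P ** diag_matrix d"
proof -
  define R where "R = {x :: complex^4. \<forall>i. cnj (x $ i) = x $ i}"
  have R: "subspace R" by (auto simp: R_def subspace_def)
  have sym: "u $ i $ j = u $ j $ i" for i j
    using u(2) by (simp add: vec_eq_iff transpose_def)
  have R1: "u *v x + conj_transpose u *v x \<in> R" if "x \<in> R" for x
    using that sym by (simp add: R_def matrix_vector_mult_def add.commute)
  have R2: "\<i> *s (u *v x - conj_transpose u *v x) \<in> R" if "x \<in> R" for x
    using that sym by (simp add: R_def matrix_vector_mult_def algebra_simps)
  have "\<forall>I v. I \<noteq> UNIV \<longrightarrow> v ` I \<subseteq> R \<longrightarrow>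
      (\<exists>x\<in>R. x \<noteq> 0 \<and> (\<forall>i\<in>I. cinner x (v (i :: 4) :: complex^4) = 0))"
  proof (intro allI impI)
    fix I and v :: "4 \<Rightarrow> complex^4"
    assume I: "I \<noteq> UNIV" and v: "v ` I \<subseteq> R"
    obtain x where x: "x \<noteq> 0" "\<And>i. i \<in> I \<Longrightarrow> cinner x (v i) = 0"
      using ex_cinner_orthogonal[OF I] by blast
    \<comment> \<open>Up to real factors, \<open>y\<close> and \<open>z\<close> are the real and
      imaginary parts of \<open>x\<close>. Since the \<open>v i\<close> are real, the conjugate of
      \<open>x\<close> is orthogonal to them as well, hence so are both parts, and one of them is
      nonzero.\<close>
    define y where "y = (\<chi> i. x $ i + cnj (x $ i))"
    define z where "z = (\<chi> i. \<i> * (x $ i - cnj (x $ i)))"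
    have "y \<in> R" "z \<in> R" by (auto simp: R_def y_def z_def algebra_simps)
    moreover have "cinner y (v i) = 0 \<and> cinner z (v i) = 0" if "i \<in> I" for i
    proof -
      have eq: "cinner (\<chi> i. cnj (x $ i)) (v i) = cnj (cinner x (v i))"
        using v that by (auto simp: cinner_def R_def)
      have "y = x + (\<chi> i. cnj (x $ i))" "z = \<i> *s (x - (\<chi> i. cnj (x $ i)))"
        by (simp_all add: y_def z_def vec_eq_iff algebra_simps)
      then show ?thesis using eq x(2)[OF that] by (simp add: cinner_add cinner_diff)
    qed
    moreover have "y \<noteq> 0 \<or> z \<noteq> 0"
    proof -
      have "x $ i = (y $ i - \<i> * z $ i) / 2" for i
        by (simp add: y_def z_def flip: mult.assoc)
      then show ?thesis using x(1) unfolding vec_eq_iff by (metis diff_zero div_0 mult_zero_right zero_index)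
    qed
    ultimately show "\<exists>x\<in>R. x \<noteq> 0 \<and> (\<forall>i\<in>I. cinner x (v i) = 0)" by blast
  qed
  then have "\<exists>P d. unitary P \<and> u ** P = P ** diag_matrix d \<and> (\<forall>j. (\<chi> i. P $ i $ j) \<in> R)"
    using unitary_diagonalization_within[OF u(1) R] R1 R2 by blast
  then obtain P d where P: "unitary P" "u ** P = P ** diag_matrix d" "\<And>j. (\<chi> i. P $ i $ j) \<in> R" by blast
  then have "map_matrix cnj P = P" by (simp add: R_def vec_eq_iff)
  then show ?thesis using that P by blast
qed

section \<open>The groups SU(4) and SO(4)\<close>

lemma diag_matrix_nth: "diag_matrix d $ i $ j = (if i = j then d i else 0)"
  by (simp add: diag_matrix_def)

lemma diag_matrix_mult_nth [simp]: "(diag_matrix d ** A) $ i $ j = d i * (A $ i $ j :: 'a::comm_semiring_1)"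
  by (simp add: diag_matrix_def matrix_matrix_mult_def if_distrib[of "\<lambda>x. x * _"] cong: if_cong)

lemma mult_diag_matrix_nth [simp]: "(A ** diag_matrix d) $ i $ j = (A $ i $ j :: 'a::comm_semiring_1) * d j"
  by (simp add: diag_matrix_def matrix_matrix_mult_def if_distrib[of "\<lambda>x. _ * x"] cong: if_cong)

lemma diag_matrix_eq_iff [simp]: "diag_matrix d = diag_matrix e \<longleftrightarrow> d = e"
  by (auto simp: diag_matrix_def vec_eq_iff fun_eq_iff)

lemma diag_matrix_mult: "diag_matrix d ** diag_matrix e = diag_matrix (\<lambda>i. d i * (e i :: 'a::comm_semiring_1))"
  by (simp add: vec_eq_iff) (simp add: diag_matrix_nth)

lemma transpose_diag_matrix [simp]: "transpose (diag_matrix d) = diag_matrix d"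
  by (auto simp: vec_eq_iff transpose_def diag_matrix_nth)

lemma conj_transpose_diag_matrix [simp]: "conj_transpose (diag_matrix d) = diag_matrix (\<lambda>i. cnj (d i))"
  by (auto simp: vec_eq_iff diag_matrix_nth)

lemma mat_eq_diag_matrix: "mat c = diag_matrix (\<lambda>_. c)"
  by (simp add: mat_def diag_matrix_def)

lemma det_diag_matrix [simp]: "det (diag_matrix d) = (\<Prod>i\<in>UNIV. d i :: 'a::comm_ring_1)"
  by (subst det_diagonal) (auto simp: diag_matrix_nth)

lemma mat_mult_mat: "mat a ** mat b = mat (a * b :: 'a::comm_semiring_1)"
  by (simp add: mat_eq_diag_matrix diag_matrix_mult)

lemma mat_eq_mat_iff [simp]: "mat a = (mat b :: 'a::zero^'n^'n) \<longleftrightarrow> a = b"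
  by (simp add: mat_eq_diag_matrix fun_eq_iff)

lemma matrix_mult_mat: "A ** mat c = mat c ** (A :: 'a::comm_semiring_1^'n^'n)"
  by (simp add: vec_eq_iff) (simp add: mat_eq_diag_matrix mult.commute)

lemma conj_transpose_mat [simp]: "conj_transpose (mat c) = mat (cnj c)"
  by (simp add: mat_eq_diag_matrix)

lemma transpose_conj_transpose: "transpose (conj_transpose A) = conj_transpose (transpose A)"
  by (simp add: vec_eq_iff transpose_def)

lemma det_conj_transpose [simp]: "det (conj_transpose A) = cnj (det A)"
proof -
  have "det (conj_transpose A) = det (transpose (conj_transpose A))"
    by (simp only: det_transpose)
  also have "\<dots> = cnj (det A)"
    by (simp add: det_def transpose_def)
  finally show ?thesis .
qed

lemma unitary_mult: "unitary A \<Longrightarrow> unitary B \<Longrightarrow> unitary (A ** B)"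
  unfolding unitary_def conj_transpose_mult by (metis matrix_mul_assoc matrix_mul_lid)

lemma unitary_conj_transpose [simp]: "unitary (conj_transpose A) \<longleftrightarrow> unitary A"
  by (auto simp: unitary_def)

lemma unitary_transpose [simp]: "unitary (transpose A) \<longleftrightarrow> unitary A"
  unfolding unitary_def
  by (metis matrix_transpose_mul transpose_conj_transpose transpose_mat transpose_transpose)

lemma unitary_cancel:
  assumes "unitary A"
  shows "A ** conj_transpose A = mat 1" "conj_transpose A ** A = mat 1"
    "A ** (conj_transpose A ** B) = B" "conj_transpose A ** (A ** B) = B"
  using assms by (simp_all add: unitary_def matrix_mul_assoc)

lemma mult_cnj_eq_1_iff: "c * cnj c = 1 \<longleftrightarrow> cmod c = 1"
proof -
  have "c * cnj c = complex_of_real ((cmod c)\<^sup>2)"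
    by (simp only: complex_norm_square)
  then have "c * cnj c = 1 \<longleftrightarrow> (cmod c)\<^sup>2 = 1"
    by (metis of_real_1 of_real_eq_iff)
  then show ?thesis
    using norm_ge_zero[of c] by (auto simp: power2_eq_1_iff)
qed

lemma unitary_diag_matrix: "unitary (diag_matrix d) \<longleftrightarrow> (\<forall>i. cmod (d i) = 1)"
  by (simp add: unitary_def mat_eq_diag_matrix diag_matrix_mult fun_eq_iff mult_cnj_eq_1_iff
      mult.commute[of "cnj _"])

lemma unitary_mat: "unitary (mat c) \<longleftrightarrow> cmod c = 1"
  by (simp add: mat_eq_diag_matrix unitary_diag_matrix)

section \<open>SU(4), and SO(4) inside it\<close>

lemma SU4_simps [simp]:
  "A \<in> carrier SU4 \<longleftrightarrow> unitary A \<and> det A = 1"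
  "A \<otimes>\<^bsub>SU4\<^esub> B = A ** B" "\<one>\<^bsub>SU4\<^esub> = mat 1"
  by (simp_all add: SU4_def)

lemma SU4_mult: "A \<in> carrier SU4 \<Longrightarrow> B \<in> carrier SU4 \<Longrightarrow> A ** B \<in> carrier SU4"
  by (simp add: unitary_mult det_mul)

lemma SU4_conj_transpose: "A \<in> carrier SU4 \<Longrightarrow> conj_transpose A \<in> carrier SU4"
  by simp

lemma group_SU4: "group SU4"
proof (rule groupI)
  show "\<exists>B\<in>carrier SU4. B \<otimes>\<^bsub>SU4\<^esub> A = \<one>\<^bsub>SU4\<^esub>" if "A \<in> carrier SU4" for A
    using that by (intro bexI[of _ "conj_transpose A"]) (auto simp: unitary_cancel)
qed (auto simp: unitary_mult det_mul matrix_mul_assoc unitary_mat)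

lemma inv_SU4: "A \<in> carrier SU4 \<Longrightarrow> inv\<^bsub>SU4\<^esub> A = conj_transpose A"
  by (rule group.inv_equality[OF group_SU4]) (auto simp: unitary_cancel)

text \<open>For a unitary matrix, \<open>A ** transpose A = mat 1\<close> says that the transpose
  and the conjugate transpose are both the inverse, so that the entries are real.\<close>

lemma SO4_iff: "A \<in> SO4 \<longleftrightarrow> A \<in> carrier SU4 \<and> A ** transpose A = mat 1"
proof
  assume "A \<in> SO4"
  then obtain Q :: "real^4^4" where Q: "rotation_matrix Q" "A = map_matrix complex_of_real Q"
    by (auto simp: SO4_def)
  have ct: "conj_transpose A = transpose A"
    by (simp add: Q vec_eq_iff transpose_def)
  have "A ** transpose A = map_matrix complex_of_real (Q ** transpose Q)"
    "transpose A ** A = map_matrix complex_of_real (transpose Q ** Q)"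
    by (simp_all add: Q vec_eq_iff matrix_matrix_mult_def transpose_def)
  moreover have "map_matrix complex_of_real (mat 1) = (mat 1 :: complex^4^4)"
    by (simp add: vec_eq_iff mat_def)
  ultimately have "A ** transpose A = mat 1" "transpose A ** A = mat 1"
    using Q(1) by (simp_all add: rotation_matrix_def orthogonal_matrix_def)
  moreover have "det A = complex_of_real (det Q)"
    by (simp add: det_def Q)
  ultimately show "A \<in> carrier SU4 \<and> A ** transpose A = mat 1"
    using Q(1) unfolding SU4_simps unitary_def ct rotation_matrix_def by simp
next
  assume A: "A \<in> carrier SU4 \<and> A ** transpose A = mat 1"
  then have "conj_transpose A = transpose A"
    by (metis SU4_simps(1) matrix_mul_rid unitary_cancel(4))
  then have "cnj (A $ i $ j) = A $ i $ j" for i j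
    by (metis (no_types, lifting) conj_transpose_nth transpose_def vec_lambda_beta)
  then have real: "complex_of_real (Re (A $ i $ j)) = A $ i $ j" for i j
    by (metis Reals_cnj_iff complex_is_Real_iff complex_eq_iff Re_complex_of_real Im_complex_of_real)
  define Q where "Q = map_matrix Re A"
  have Q: "A = map_matrix complex_of_real Q"
    by (simp add: Q_def vec_eq_iff real)
  have "map_matrix complex_of_real (Q ** transpose Q) = A ** transpose A"
    by (simp add: Q vec_eq_iff matrix_matrix_mult_def transpose_def)
  also have "\<dots> = map_matrix complex_of_real (mat 1)"
    using A by (simp add: vec_eq_iff mat_def)
  finally have "Q ** transpose Q = mat 1"
    by (simp add: vec_eq_iff)
  moreover have "complex_of_real (det Q) = det A"
    by (simp add: det_def Q)
  ultimately have "rotation_matrix Q"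
    using A by (simp add: rotation_matrix_def orthogonal_matrix_def matrix_left_right_inverse)
  then show "A \<in> SO4" by (auto simp: SO4_def Q)
qed

lemma SO4_conj_transpose: "A \<in> SO4 \<Longrightarrow> conj_transpose A = transpose A"
  unfolding SO4_iff by (metis SU4_simps(1) matrix_mul_rid unitary_cancel(4))

lemma SO4_transpose: "A \<in> SO4 \<Longrightarrow> transpose A \<in> SO4"
  unfolding SO4_iff
  by (simp add: matrix_left_right_inverse)

lemma SO4_one: "mat 1 \<in> SO4"
  by (simp add: SO4_iff unitary_mat)

lemma SO4_cancel:
  assumes "A \<in> SO4"
  shows "A ** transpose A = mat 1" "transpose A ** A = mat 1"
    "A ** (transpose A ** B) = B" "transpose A ** (A ** B) = B"
proof -
  show "A ** transpose A = mat 1" "transpose A ** A = mat 1"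
    using assms by (simp_all add: SO4_iff matrix_left_right_inverse)
  then show "A ** (transpose A ** B) = B" "transpose A ** (A ** B) = B"
    by (simp_all add: matrix_mul_assoc)
qed

lemma SO4_mult: "A \<in> SO4 \<Longrightarrow> B \<in> SO4 \<Longrightarrow> A ** B \<in> SO4"
  by (simp add: SO4_iff unitary_mult det_mul matrix_transpose_mul)
    (simp add: SO4_cancel SO4_iff flip: matrix_mul_assoc)

text \<open>A permutation matrix has determinant \<open>sign \<pi>\<close>. Scaling one row by this
  sign brings it into SO(4), and the scaling commutes with diagonal matrices, so their entries are
  still permuted by \<open>\<pi>\<close>.\<close>

lemma ex_signed_permutation:
  fixes \<pi> :: "4 \<Rightarrow> 4"
  assumes "\<pi> permutes UNIV"
  shows "\<exists>P\<in>SO4. \<forall>s. P ** diag_matrix s = diag_matrix (s \<circ> \<pi>) ** P"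
proof -
  define \<epsilon> :: "4 \<Rightarrow> complex" where "\<epsilon> i = (if i = 0 then of_int (sign \<pi>) else 1)" for i
  define P0 :: "complex^4^4" where "P0 = (\<chi> i. mat 1 $ \<pi> i)"
  define P where "P = diag_matrix \<epsilon> ** P0"
  have P0: "P0 $ i $ j = (if \<pi> i = j then 1 else 0)" for i j
    by (simp add: P0_def mat_def)
  have sgn: "\<epsilon> i * \<epsilon> i = 1" "cnj (\<epsilon> i) = \<epsilon> i" for i
    by (auto simp: \<epsilon>_def sign_def)
  have inj: "\<pi> i = \<pi> j \<longleftrightarrow> i = j" for i j
    using assms by (metis permutes_inj injD)
  have P: "P $ i $ j = (if \<pi> i = j then \<epsilon> i else 0)" for i j
    by (simp add: P_def P0)
  have "(P ** transpose P) $ i $ j = (if \<pi> j = \<pi> i then \<epsilon> i * \<epsilon> j else 0)" for i j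
    by (simp add: matrix_matrix_mult_def transpose_def P if_distrib[of "\<lambda>x. x * _"] cong: if_cong)
  then have "P ** transpose P = mat 1"
    by (simp add: vec_eq_iff mat_def inj sgn)
  moreover have ct: "conj_transpose P = transpose P"
    by (auto simp: vec_eq_iff transpose_def P_def P0 sgn)
  moreover have "det P = of_int (sign \<pi>) * of_int (sign \<pi>)"
    using assms by (simp add: P_def det_mul P0_def det_permute_rows \<epsilon>_def)
  then have "det P = 1" by (simp add: sign_def)
  ultimately have "P \<in> SO4"
    by (simp add: SO4_iff unitary_def matrix_left_right_inverse)
  moreover have "P ** diag_matrix s = diag_matrix (s \<circ> \<pi>) ** P" for s
    by (auto simp: vec_eq_iff P_def P0)
  ultimately show ?thesis by blast
qed

lemma diag_matrix_similar_permutation: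
  fixes P :: "'a::idom^'n^'n"
  assumes "P ** diag_matrix s = diag_matrix s' ** P" and "det P \<noteq> 0"
  shows "\<exists>\<pi>. \<pi> permutes UNIV \<and> s' = s \<circ> \<pi>"
proof -
  \<comment> \<open>any permutation with a nonzero term in the Leibniz expansion of \<open>det P\<close> works\<close>
  obtain \<pi> where \<pi>: "\<pi> permutes UNIV" "of_int (sign \<pi>) * (\<Prod>i\<in>UNIV. P $ i $ \<pi> i) \<noteq> 0"
    using assms(2) unfolding det_def by (metis (mono_tags, lifting) mem_Collect_eq sum.neutral)
  have "s' i = s (\<pi> i)" for i
  proof -
    have "P $ i $ \<pi> i \<noteq> 0" using \<pi>(2) by auto
    moreover have "P $ i $ \<pi> i * s (\<pi> i) = s' i * P $ i $ \<pi> i"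
      using assms(1) by (metis diag_matrix_mult_nth mult_diag_matrix_nth)
    ultimately show ?thesis by (simp add: mult.commute)
  qed
  then show ?thesis using \<pi>(1) by (auto simp: fun_eq_iff)
qed

text \<open>Diagonal sign matrices in SO(4) kill the off-diagonal entries of \<open>M\<close>;
  signed permutation matrices then make the diagonal entries equal.\<close>

lemma commutes_SO4_imp_scalar:
  assumes "\<And>V. V \<in> SO4 \<Longrightarrow> M ** V = V ** M"
  shows "\<exists>z. M = mat z"
proof -
  have off: "M $ a $ b = 0" if "a \<noteq> b" for a b
  proof -
    have "card {a, b} < CARD(4)" using that by simp
    then have "{a, b} \<noteq> UNIV" by auto
    then obtain c where c: "c \<noteq> a" "c \<noteq> b" by blast
    \<comment> \<open>\<open>s\<close> has opposite signs at \<open>a\<close> and \<open>b\<close>,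
      so commutation forces the entry at \<open>(a, b)\<close> to equal its own negative. The second
      sign, at \<open>c\<close>, makes the determinant 1.\<close>
    define s :: "4 \<Rightarrow> complex" where "s i = (if i \<in> {a, c} then - 1 else 1)" for i
    have "(\<Prod>i\<in>UNIV. s i) = (\<Prod>i\<in>{a, c}. - 1)"
      unfolding s_def by (subst prod.inter_restrict[symmetric]) auto
    then have "diag_matrix s \<in> SO4"
      using c by (simp add: SO4_iff unitary_diag_matrix diag_matrix_mult mat_eq_diag_matrix) (auto simp: s_def fun_eq_iff)
    from arg_cong[OF assms[OF this], of "\<lambda>A. A $ a $ b"] show ?thesis
      using c that by (simp add: s_def)
  qed
  define m where "m i = M $ i $ i" for i
  have M: "M = diag_matrix m"
    using off by (auto simp: vec_eq_iff diag_matrix_nth m_def)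
  have "m a = m b" for a b
  proof -
    have "Transposition.transpose a b permutes UNIV" by (simp add: permutes_swap_id)
    from ex_signed_permutation[OF this] obtain P where P: "P \<in> SO4"
      and "\<forall>s. P ** diag_matrix s = diag_matrix (s \<circ> Transposition.transpose a b) ** P" ..
    then have "P ** M = diag_matrix (m \<circ> Transposition.transpose a b) ** P"
      using M by simp
    then have "M ** P = diag_matrix (m \<circ> Transposition.transpose a b) ** P"
      by (simp only: assms[OF P])
    then have "M ** P ** transpose P = diag_matrix (m \<circ> Transposition.transpose a b) ** P ** transpose P"
      by (rule arg_cong)
    then have "diag_matrix m = diag_matrix (m \<circ> Transposition.transpose a b)"
      unfolding matrix_mul_assoc[symmetric] SO4_cancel(1)[OF P] matrix_mul_rid M .
    then have "m = m \<circ> Transposition.transpose a b"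
      by (simp only: diag_matrix_eq_iff)
    from fun_cong[OF this, of a] show ?thesis by simp
  qed
  then have "m = (\<lambda>_. m 0)" by (intro ext)
  then have "M = mat (m 0)"
    unfolding M mat_eq_diag_matrix diag_matrix_eq_iff .
  then show ?thesis ..
qed

section \<open>The normalizer of SO(4) and the double cosets\<close>

text \<open>\<open>transpose g ** g\<close> is \<open>g ** transpose g\<close> conjugated by the
  inverse of \<open>g\<close>, and conjugation fixes scalars.\<close>

lemma transpose_mult_eq_mat:
  fixes g :: "complex^4^4"
  assumes "unitary g"
  shows "g ** transpose g = mat z \<longleftrightarrow> transpose g ** g = mat z"
proof -
  have tg: "unitary (transpose g)" using assms by simp
  note simps = unitary_cancel[OF assms] unitary_cancel[OF tg]
  have "transpose g ** g = mat z" if "g ** transpose g = mat z"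
  proof -
    have "transpose g ** g = conj_transpose g ** (g ** transpose g) ** g"
      by (simp add: simps flip: matrix_mul_assoc)
    also have "\<dots> = mat z"
      unfolding that by (simp add: simps matrix_mult_mat[of "conj_transpose g"] flip: matrix_mul_assoc)
    finally show ?thesis .
  qed
  moreover have "g ** transpose g = mat z" if "transpose g ** g = mat z"
  proof -
    have "g ** transpose g = g ** (transpose g ** g) ** conj_transpose g"
      by (simp add: simps flip: matrix_mul_assoc)
    also have "\<dots> = mat z"
      unfolding that by (simp add: simps matrix_mult_mat[of g] flip: matrix_mul_assoc)
    finally show ?thesis .
  qed
  ultimately show ?thesis by blast
qed

text \<open>Unfolds the stabilizer of a subset under conjugation into an equation between sets of
  elements, the form used for both SO(4) and the torus.\<close>

lemma (in group) mem_normalizer_iff: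
  assumes "H \<subseteq> carrier G"
  shows "g \<in> normalizer G H \<longleftrightarrow> g \<in> carrier G \<and> (\<lambda>h. g \<otimes> h \<otimes> inv g) ` H = H"
proof -
  have "(g <# H) #> inv g = (\<lambda>h. g \<otimes> h \<otimes> inv g) ` H"
    by (auto simp: l_coset_def r_coset_def)
  then show ?thesis
    using assms by (simp add: normalizer_def stabilizer_def)
qed

lemma SO4_subset: "SO4 \<subseteq> carrier SU4"
  using SO4_iff by blast

lemma torus_subset: "torus \<subseteq> carrier SU4"
  by (auto simp: torus_def)

lemma normalizer_SU4_iff:
  assumes "H \<subseteq> carrier SU4"
  shows "g \<in> normalizer SU4 H \<longleftrightarrow> g \<in> carrier SU4 \<and> (\<lambda>h. g ** h ** conj_transpose g) ` H = H"
proof -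
  have *: "(\<lambda>h. g \<otimes>\<^bsub>SU4\<^esub> h \<otimes>\<^bsub>SU4\<^esub> inv\<^bsub>SU4\<^esub> g) ` H = (\<lambda>h. g ** h ** conj_transpose g) ` H"
    if "g \<in> carrier SU4"
    using inv_SU4[OF that] by simp
  show ?thesis
    unfolding group.mem_normalizer_iff[OF group_SU4 assms]
    by (rule conj_cong[OF refl]) (simp only: *)
qed

text \<open>If \<open>g\<close> normalizes SO(4), orthogonality of
  \<open>g ** V ** conj_transpose g\<close> says that \<open>V\<close> commutes with the inverse of
  \<open>transpose g ** g\<close>; holding for all \<open>V\<close>, this makes that matrix scalar.
  Conversely a scalar cancels in the same computation.\<close>

lemma N4_iff: "g \<in> N4 \<longleftrightarrow> g \<in> carrier SU4 \<and> (\<exists>z. g ** transpose g = mat z)"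
proof
  assume "g \<in> N4"
  then have g: "g \<in> carrier SU4" and N: "(\<lambda>V. g ** V ** conj_transpose g) ` SO4 = SO4"
    using normalizer_SU4_iff[OF SO4_subset] by (auto simp: N4_def)
  have u: "unitary g" "unitary (transpose g)" using g by simp_all
  \<comment> \<open>By unitarity this is the inverse of \<open>transpose g ** g\<close>.\<close>
  define S where "S = conj_transpose g ** conj_transpose (transpose g)"
  have "S ** V = V ** S" if V: "V \<in> SO4" for V
  proof -
    have "g ** V ** conj_transpose g \<in> SO4" using N V by blast
    then have "g ** (V ** S ** transpose V) ** transpose g = mat 1"
      by (simp add: SO4_iff S_def matrix_transpose_mul transpose_conj_transpose matrix_mul_assoc)
    then have "conj_transpose g ** (g ** (V ** S ** transpose V) ** transpose g) ** conj_transpose (transpose g) = S"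
      by (simp add: S_def)
    then have "V ** S ** transpose V = S"
      by (simp add: unitary_cancel[OF u(1)] unitary_cancel[OF u(2)] flip: matrix_mul_assoc)
    then have "V ** S ** transpose V ** V = S ** V" by simp
    then show ?thesis by (simp add: SO4_cancel[OF V] flip: matrix_mul_assoc)
  qed
  then obtain z where "S = mat z" using commutes_SO4_imp_scalar by blast
  then have "conj_transpose (transpose g ** g) = mat z" by (simp add: S_def conj_transpose_mult)
  then have "transpose g ** g = mat (cnj z)"
    by (metis conj_transpose_conj_transpose conj_transpose_mat)
  then show "g \<in> carrier SU4 \<and> (\<exists>z. g ** transpose g = mat z)"
    using g transpose_mult_eq_mat[OF u(1)] by blast
next
  assume "g \<in> carrier SU4 \<and> (\<exists>z. g ** transpose g = mat z)"
  then obtain z where g: "g \<in> carrier SU4" "g ** transpose g = mat z" by blast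
  \<comment> \<open>Stated for all \<open>h\<close> so as to apply to \<open>g\<close> and to its
    inverse, which give the two inclusions in the normalizer condition.\<close>
  have closed: "h ** V ** conj_transpose h \<in> SO4"
    if h: "h \<in> carrier SU4" "h ** transpose h = mat w" and V: "V \<in> SO4" for h w V
  proof -
    have u: "unitary h" "unitary (transpose h)" using h by simp_all
    have "transpose h ** h = mat w" using h transpose_mult_eq_mat u by blast
    then have ct: "conj_transpose h ** conj_transpose (transpose h) = mat (cnj w)"
      by (metis conj_transpose_mat conj_transpose_mult)
    have "(h ** V ** conj_transpose h) ** transpose (h ** V ** conj_transpose h) =
        h ** V ** (conj_transpose h ** conj_transpose (transpose h)) ** transpose V ** transpose h"
      by (simp add: matrix_transpose_mul transpose_conj_transpose matrix_mul_assoc)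
    also have "\<dots> = mat (cnj w) ** (h ** V ** transpose V ** transpose h)"
      by (simp only: ct matrix_mult_mat[of "h ** V"] matrix_mul_assoc)
    also have "h ** V ** transpose V ** transpose h = mat w"
      by (simp add: SO4_cancel[OF V] h(2) flip: matrix_mul_assoc)
    also have "mat (cnj w) ** mat w = (mat 1 :: complex^4^4)"
      using unitary_mult[OF u] h(2) by (metis unitary_cancel(2) conj_transpose_mat)
    finally show ?thesis
      using h V by (simp add: SO4_iff unitary_mult det_mul)
  qed
  have "transpose g ** g = mat z" using g transpose_mult_eq_mat by simp
  then have "conj_transpose g ** transpose (conj_transpose g) = mat (cnj z)"
    by (metis conj_transpose_mat conj_transpose_mult transpose_conj_transpose)
  then have "conj_transpose g ** V ** g \<in> SO4" if "V \<in> SO4" for V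
    using closed[of "conj_transpose g"] g that by simp
  moreover have "V = g ** (conj_transpose g ** V ** g) ** conj_transpose g" for V
    using g by (simp add: unitary_cancel flip: matrix_mul_assoc)
  ultimately have "(\<lambda>V. g ** V ** conj_transpose g) ` SO4 = SO4"
    using closed[OF g] by (auto simp: image_iff)
  then show "g \<in> N4"
    using g normalizer_SU4_iff[OF SO4_subset] by (simp add: N4_def)
qed

lemma N4_cmod: assumes "g \<in> N4" "g ** transpose g = mat z" shows "cmod z = 1"
  using assms unitary_mult[of g "transpose g"] by (simp add: N4_iff unitary_mat)

lemma N4_mult: assumes "g \<in> N4" "h \<in> N4" shows "g ** h \<in> N4"
proof -
  obtain z w where z: "g ** transpose g = mat z" and w: "h ** transpose h = mat w"
    using assms by (auto simp: N4_iff)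
  have "(g ** h) ** transpose (g ** h) = g ** (h ** transpose h) ** transpose g"
    by (simp add: matrix_transpose_mul matrix_mul_assoc)
  also have "\<dots> = mat w ** (g ** transpose g)"
    by (simp add: w matrix_mult_mat[of g] matrix_mul_assoc)
  also have "\<dots> = mat (w * z)" by (simp add: z mat_mult_mat)
  finally show ?thesis
    using assms by (auto simp: N4_iff unitary_mult det_mul)
qed

lemma N4_conj_transpose: assumes "g \<in> N4" shows "conj_transpose g \<in> N4"
proof -
  obtain z where "g ** transpose g = mat z" using assms by (auto simp: N4_iff)
  then have "transpose g ** g = mat z" using assms transpose_mult_eq_mat by (simp add: N4_iff)
  then have "conj_transpose g ** transpose (conj_transpose g) = mat (cnj z)"
    by (metis conj_transpose_mat conj_transpose_mult transpose_conj_transpose)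
  then show ?thesis using assms by (auto simp: N4_iff)
qed

lemma SO4_subset_N4: "SO4 \<subseteq> N4"
  by (auto simp: SO4_iff N4_iff)

section \<open>Double cosets as an equivalence relation\<close>

lemma double_coset_eq: "double_coset u = {V ** u ** n | V n. V \<in> SO4 \<and> n \<in> N4}"
  by (auto simp: double_coset_def set_mult_def l_coset_def matrix_mul_assoc)

lemma double_coset_mono:
  assumes "u \<in> double_coset v"
  shows "double_coset u \<subseteq> double_coset v"
proof
  fix x assume "x \<in> double_coset u"
  then obtain V n W m where *: "V \<in> SO4" "W \<in> SO4" "n \<in> N4" "m \<in> N4" "x = V ** (W ** v ** m) ** n"
    using assms by (auto simp: double_coset_eq)
  then have "x = (V ** W) ** v ** (m ** n)" by (simp add: matrix_mul_assoc)
  then show "x \<in> double_coset v"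
    using SO4_mult[OF *(1,2)] N4_mult[OF *(4,3)] unfolding double_coset_eq by blast
qed

lemma double_coset_self: "u \<in> double_coset u"
  using SO4_one SO4_subset_N4 by (force simp: double_coset_eq)

lemma double_coset_sym:
  assumes "u \<in> double_coset v" shows "v \<in> double_coset u"
proof -
  obtain V n where *: "V \<in> SO4" "n \<in> N4" "u = V ** v ** n"
    using assms by (auto simp: double_coset_eq)
  then have "v = transpose V ** u ** conj_transpose n"
    by (simp add: SO4_cancel unitary_cancel N4_iff flip: matrix_mul_assoc)
  then show ?thesis
    using * SO4_transpose N4_conj_transpose by (auto simp: double_coset_eq)
qed

lemma double_coset_eq_iff: "double_coset u = double_coset v \<longleftrightarrow> u \<in> double_coset v"
  using double_coset_mono double_coset_self double_coset_sym by blast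

section \<open>Orbits of symmetric unitary matrices\<close>

lemma moduli_class_eq:
  "moduli_class L = {mat (c\<^sup>2) ** (V ** L ** transpose V) | c V. cmod c = 1 \<and> V \<in> SO4}"
  by (auto simp: moduli_class_def orbit_def U1_def DirProd_def moduli_action_def)

lemma moduli_class_mono:
  assumes "L \<in> moduli_class M"
  shows "moduli_class L \<subseteq> moduli_class M"
proof
  fix x assume "x \<in> moduli_class L"
  then obtain c V d W where *: "cmod c = 1" "cmod d = 1" "V \<in> SO4" "W \<in> SO4"
    "x = mat (c\<^sup>2) ** (V ** (mat (d\<^sup>2) ** (W ** M ** transpose W)) ** transpose V)"
    using assms by (auto simp: moduli_class_eq)
  have "x = mat (c\<^sup>2) ** mat (d\<^sup>2) ** (V ** (W ** M ** transpose W) ** transpose V)"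
    unfolding *(5) by (simp add: matrix_mul_assoc matrix_mult_mat[of V])
  also have "\<dots> = mat ((c * d)\<^sup>2) ** ((V ** W) ** M ** transpose (V ** W))"
    by (simp add: mat_mult_mat power_mult_distrib matrix_transpose_mul matrix_mul_assoc)
  finally show "x \<in> moduli_class M"
    using * SO4_mult[of V W] unfolding moduli_class_eq
    by (intro CollectI exI[of _ "c * d"] exI[of _ "V ** W"]) (simp add: norm_mult)
qed

lemma moduli_class_self: "L \<in> moduli_class L"
  unfolding moduli_class_eq
  by (intro CollectI exI[of _ 1] exI[of _ "mat 1"]) (simp add: SO4_one)

lemma moduli_class_sym:
  assumes "L \<in> moduli_class M" shows "M \<in> moduli_class L"
proof -
  obtain c V where *: "cmod c = 1" "V \<in> SO4" "L = mat (c\<^sup>2) ** (V ** M ** transpose V)"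
    using assms by (auto simp: moduli_class_eq)
  have "cnj c * c = 1" using *(1) mult_cnj_eq_1_iff[of c] by (simp add: mult.commute)
  have "mat ((cnj c)\<^sup>2) ** (transpose V ** L ** transpose (transpose V)) =
      mat ((cnj c)\<^sup>2) ** mat (c\<^sup>2) ** (transpose V ** (V ** M ** transpose V) ** V)"
    unfolding *(3) by (simp add: matrix_mul_assoc matrix_mult_mat[of "transpose V"])
  also have "\<dots> = M"
    using \<open>cnj c * c = 1\<close> by (simp add: SO4_cancel[OF *(2)] mat_mult_mat flip: matrix_mul_assoc power_mult_distrib)
  finally show ?thesis
    unfolding moduli_class_eq using * SO4_transpose
    by (intro CollectI exI[of _ "cnj c"] exI[of _ "transpose V"]) simp
qed

lemma moduli_class_eq_iff: "moduli_class L = moduli_class M \<longleftrightarrow> L \<in> moduli_class M"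
  using moduli_class_mono moduli_class_self moduli_class_sym by blast

lemma mult_transpose_mem_sym_unitary: "u \<in> carrier SU4 \<Longrightarrow> u ** transpose u \<in> sym_unitary"
  by (simp add: sym_unitary_def unitary_mult matrix_transpose_mul)

text \<open>The right factor in N contributes only the scalar \<open>n ** transpose n\<close>, the
  left factor in SO(4) only a conjugation.\<close>

lemma mult_transpose_double_coset:
  assumes "u \<in> double_coset v"
  obtains z V where "cmod z = 1" "V \<in> SO4" "u ** transpose u = mat z ** (V ** (v ** transpose v) ** transpose V)"
proof -
  obtain V n where *: "V \<in> SO4" "n \<in> N4" "u = V ** v ** n"
    using assms by (auto simp: double_coset_eq)
  obtain z where z: "n ** transpose n = mat z" using * by (auto simp: N4_iff)
  have "u ** transpose u = (V ** v) ** (n ** transpose n) ** (transpose v ** transpose V)"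
    by (simp add: * matrix_transpose_mul matrix_mul_assoc)
  also have "\<dots> = mat z ** (V ** (v ** transpose v) ** transpose V)"
    by (simp add: z matrix_mult_mat[of "V ** v"] matrix_mul_assoc)
  finally show ?thesis using that N4_cmod[OF *(2) z] * by blast
qed

text \<open>Well-definedness and injectivity of the map from double cosets to orbits that
  \<open>u ** transpose u\<close> induces.\<close>

lemma double_coset_iff_moduli_class:
  assumes "u \<in> carrier SU4" "v \<in> carrier SU4"
  shows "double_coset u = double_coset v \<longleftrightarrow> moduli_class (u ** transpose u) = moduli_class (v ** transpose v)"
  unfolding double_coset_eq_iff moduli_class_eq_iff
proof
  assume "u \<in> double_coset v"
  then obtain z V where "cmod z = 1" "V \<in> SO4" "u ** transpose u = mat z ** (V ** (v ** transpose v) ** transpose V)"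
    by (rule mult_transpose_double_coset)
  \<comment> \<open>U(1) acts through \<open>c\<^sup>2\<close>, so a square root of \<open>z\<close>
    is needed.\<close>
  then show "u ** transpose u \<in> moduli_class (v ** transpose v)"
    unfolding moduli_class_eq by (intro CollectI exI[of _ "csqrt z"] exI[of _ V]) (simp add: norm_csqrt)
next
  assume "u ** transpose u \<in> moduli_class (v ** transpose v)"
  then obtain c V where *: "cmod c = 1" "V \<in> SO4" "u ** transpose u = mat (c\<^sup>2) ** (V ** (v ** transpose v) ** transpose V)"
    by (auto simp: moduli_class_eq)
  \<comment> \<open>Solved from \<open>u = V ** v ** n\<close>; the assumption on
    \<open>u ** transpose u\<close> makes \<open>n ** transpose n\<close> scalar.\<close>
  define n where "n = conj_transpose v ** transpose V ** u"
  have v: "unitary v" "unitary (transpose v)" using assms by simp_all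
  have n: "n \<in> carrier SU4"
    using assms SO4_subset SO4_transpose[OF *(2)] by (auto simp: n_def unitary_mult det_mul)
  have "n ** transpose n = conj_transpose v ** transpose V ** (u ** transpose u) ** V ** conj_transpose (transpose v)"
    by (simp add: n_def matrix_transpose_mul transpose_conj_transpose matrix_mul_assoc)
  also have "\<dots> = mat (c\<^sup>2) ** (conj_transpose v ** transpose V ** (V ** (v ** transpose v) ** transpose V) ** V ** conj_transpose (transpose v))"
    unfolding *(3) by (simp add: matrix_mul_assoc matrix_mult_mat[of "conj_transpose v ** transpose V"])
  also have "\<dots> = mat (c\<^sup>2)"
    by (simp add: SO4_cancel[OF *(2)] unitary_cancel[OF v(1)] unitary_cancel[OF v(2)] flip: matrix_mul_assoc)
  finally have "n \<in> N4" using n N4_iff by blast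
  moreover have "u = V ** v ** n"
    by (simp add: n_def SO4_cancel[OF *(2)] unitary_cancel[OF v(1)] flip: matrix_mul_assoc)
  ultimately show "u \<in> double_coset v" using * by (auto simp: double_coset_eq)
qed

section \<open>The maximal torus and the Weyl group\<close>

lemma torus_iff: "t \<in> torus \<longleftrightarrow> (\<exists>d. t = diag_matrix d \<and> (\<forall>i. cmod (d i) = 1) \<and> prod d UNIV = 1)"
proof
  assume t: "t \<in> torus"
  then have eq: "t = diag_matrix (\<lambda>i. t $ i $ i)"
    by (auto simp: torus_def vec_eq_iff diag_matrix_nth)
  from t have "unitary t" "det t = 1" by (auto simp: torus_def)
  then have "unitary (diag_matrix (\<lambda>i. t $ i $ i))" "det (diag_matrix (\<lambda>i. t $ i $ i)) = 1"
    by (simp_all only: eq[symmetric])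
  then have "\<forall>i. cmod (t $ i $ i) = 1" "(\<Prod>i\<in>UNIV. t $ i $ i) = 1"
    by (simp_all add: unitary_diag_matrix)
  then show "\<exists>d. t = diag_matrix d \<and> (\<forall>i. cmod (d i) = 1) \<and> prod d UNIV = 1"
    using eq by (intro exI[of _ "\<lambda>i. t $ i $ i"]) blast
qed (auto simp: torus_def unitary_diag_matrix diag_matrix_nth)

lemma torusE:
  assumes "t \<in> torus"
  obtains d where "t = diag_matrix d" "\<forall>i. cmod (d i) = 1" "prod d UNIV = 1"
  using assms torus_iff by blast

lemma cmod_det_unitary: "unitary A \<Longrightarrow> cmod (det A) = 1"
  by (metis det_I det_conj_transpose det_mul mult_cnj_eq_1_iff unitary_cancel(1))

lemma det_mat: "det (mat c :: complex^4^4) = c ^ 4"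
  by (simp add: mat_eq_diag_matrix)

lemma unitary_scale_SU4:
  assumes "unitary A"
  obtains c where "cmod c = 1" "mat c ** A \<in> carrier SU4"
proof
  \<comment> \<open>Scaling by \<open>c\<close> multiplies the determinant by \<open>c ^ 4\<close>,
    so a fourth root of the conjugate, hence inverse, determinant is taken.\<close>
  define c where "c = csqrt (csqrt (cnj (det A)))"
  have "c ^ 4 = (c\<^sup>2)\<^sup>2" by (simp flip: power_mult)
  then have "c ^ 4 = cnj (det A)" by (simp add: c_def)
  then show "mat c ** A \<in> carrier SU4"
    using assms cmod_det_unitary[OF assms] mult_cnj_eq_1_iff[of "det A"]
    by (simp add: c_def unitary_mult unitary_mat norm_csqrt det_mul det_mat mult.commute)
  show "cmod c = 1"
    using cmod_det_unitary[OF assms] by (simp add: c_def norm_csqrt)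
qed

text \<open>Entrywise square roots have product \<open>\<delta>\<close> with
  \<open>\<delta>\<^sup>2 = 1\<close>; multiplying one entry by \<open>\<delta>\<close> corrects the
  determinant without changing the square.\<close>

lemma torus_sqrt:
  assumes "s \<in> torus"
  obtains t where "t \<in> torus" "t ** t = s"
proof -
  obtain d where d: "s = diag_matrix d" "\<forall>i. cmod (d i) = 1" "prod d UNIV = 1"
    using assms by (rule torusE)
  define \<delta> where "\<delta> = (\<Prod>i\<in>UNIV. csqrt (d i))"
  define r where "r i = (if i = 0 then \<delta> else 1) * csqrt (d i)" for i
  have "\<delta>\<^sup>2 = 1"
    using d(3) by (simp add: \<delta>_def prod_power_distrib)
  then have "r i * r i = d i" for i
    by (auto simp: r_def mult_ac power2_eq_square[symmetric] simp flip: mult.assoc power_mult_distrib)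
      (simp add: power_mult_distrib)
  moreover have "prod r UNIV = 1"
    using \<open>\<delta>\<^sup>2 = 1\<close> by (simp add: r_def prod.distrib power2_eq_square flip: \<delta>_def)
  moreover have "cmod (r i) = 1" for i
    using \<open>\<delta>\<^sup>2 = 1\<close> d(2) by (simp add: r_def norm_mult norm_csqrt power2_eq_1_iff) auto
  ultimately show ?thesis
    using that[of "diag_matrix r"] d by (auto simp: torus_iff diag_matrix_mult)
qed

lemma torus_mult: "s \<in> torus \<Longrightarrow> t \<in> torus \<Longrightarrow> s ** t \<in> torus"
  by (auto simp: torus_iff diag_matrix_mult norm_mult prod.distrib)

lemma symmetric_unitary_SO4_diagonalization:
  assumes "L \<in> sym_unitary"
  obtains V d where "V \<in> SO4" "unitary (diag_matrix d)" "L = V ** diag_matrix d ** transpose V"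
proof -
  have L: "unitary L" "transpose L = L" using assms by (auto simp: sym_unitary_def)
  obtain P d where P: "unitary P" "map_matrix cnj P = P" "L ** P = P ** diag_matrix d"
    by (rule symmetric_unitary_diagonalization[OF L])
  have ct: "conj_transpose P = transpose P"
    using P(2) by (simp add: conj_transpose_def vec_eq_iff transpose_def)
  \<comment> \<open>A real unitary matrix has determinant 1 or -1; scaling one column by it leads
    into SO(4). The scaling commutes with \<open>diag_matrix d\<close>, so the columns stay
    eigenvectors.\<close>
  define \<epsilon> :: "4 \<Rightarrow> complex" where "\<epsilon> i = (if i = 0 then det P else 1)" for i
  define V where "V = P ** diag_matrix \<epsilon>"
  have detP: "det P * det P = 1"
    using arg_cong[OF unitary_cancel(1)[OF P(1)], of det] by (simp add: ct det_mul)
  then have \<epsilon>: "diag_matrix \<epsilon> ** diag_matrix \<epsilon> = mat 1"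
    by (simp add: diag_matrix_mult mat_eq_diag_matrix \<epsilon>_def fun_eq_iff)
  have "cmod (\<epsilon> i) = 1" for i
    using cmod_det_unitary[OF P(1)] by (simp add: \<epsilon>_def)
  then have "unitary V" using P(1) by (simp add: V_def unitary_mult unitary_diag_matrix)
  moreover have "det V = 1" using detP by (simp add: V_def det_mul \<epsilon>_def)
  moreover have "V ** transpose V = P ** (diag_matrix \<epsilon> ** diag_matrix \<epsilon>) ** transpose P"
    by (simp add: V_def matrix_transpose_mul matrix_mul_assoc)
  then have "V ** transpose V = mat 1"
    using unitary_cancel(1)[OF P(1)] by (simp add: \<epsilon> ct)
  ultimately have V: "V \<in> SO4" by (simp add: SO4_iff)
  have "L ** V = V ** diag_matrix d"
  proof -
    have "L ** V = P ** (diag_matrix d ** diag_matrix \<epsilon>)"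
      by (simp add: V_def P(3) matrix_mul_assoc)
    also have "diag_matrix d ** diag_matrix \<epsilon> = diag_matrix \<epsilon> ** diag_matrix d"
      by (simp add: diag_matrix_mult mult.commute)
    finally show ?thesis by (simp add: V_def matrix_mul_assoc)
  qed
  then have "V ** diag_matrix d ** transpose V = L ** (V ** transpose V)"
    by (simp add: matrix_mul_assoc)
  then have "L = V ** diag_matrix d ** transpose V"
    by (simp add: SO4_cancel[OF V])
  moreover have "diag_matrix d = transpose V ** (L ** V)"
    by (simp add: \<open>L ** V = _\<close> SO4_cancel[OF V])
  then have "unitary (diag_matrix d)"
    using L V by (simp add: unitary_mult SO4_iff)
  ultimately show ?thesis using that V by blast
qed

text \<open>If \<open>L\<close> is diagonalized by \<open>V\<close> and \<open>r\<close> consists of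
  square roots of its eigenvalues, then \<open>V ** diag_matrix r\<close> times its transpose is
  \<open>L\<close>. The scalar that corrects the determinant changes \<open>L\<close> only by the
  action of U(1).\<close>

lemma moduli_class_surj:
  assumes "L \<in> sym_unitary"
  shows "\<exists>u\<in>carrier SU4. moduli_class L = moduli_class (u ** transpose u)"
proof -
  obtain V d where V: "V \<in> SO4" and d: "unitary (diag_matrix d)"
    and L: "L = V ** diag_matrix d ** transpose V"
    using assms by (rule symmetric_unitary_SO4_diagonalization)
  define r where "r i = csqrt (d i)" for i
  have r: "diag_matrix r ** diag_matrix r = diag_matrix d"
    by (simp add: r_def diag_matrix_mult flip: power2_eq_square)
  have "unitary (diag_matrix r)"
    using d by (simp add: unitary_diag_matrix r_def norm_csqrt)
  then have "unitary (V ** diag_matrix r)"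
    using V by (simp add: unitary_mult SO4_iff)
  then obtain c where c: "cmod c = 1" "mat c ** (V ** diag_matrix r) \<in> carrier SU4"
    by (rule unitary_scale_SU4)
  define u where "u = mat c ** (V ** diag_matrix r)"
  have "u ** transpose u = mat c ** (V ** (diag_matrix r ** diag_matrix r) ** transpose V) ** mat c"
    by (simp add: u_def matrix_transpose_mul matrix_mul_assoc mat_eq_diag_matrix)
  also have "\<dots> = mat (c\<^sup>2) ** L"
    by (simp add: r L[symmetric] matrix_mult_mat[of "mat c ** L"] matrix_mul_assoc mat_mult_mat power2_eq_square)
  finally have "u ** transpose u \<in> moduli_class L"
    unfolding moduli_class_eq using c(1) SO4_one
    by (intro CollectI exI[of _ c] exI[of _ "mat 1"]) simp
  then show ?thesis
    using c(2) moduli_class_sym unfolding moduli_class_eq_iff u_def by blast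
qed

text \<open>The decomposition of SU(4) as SO(4) T SO(4): if \<open>t ** t\<close> is the diagonal
  form of \<open>u ** transpose u\<close>, then what is left of \<open>u\<close> after removing
  \<open>V\<close> and \<open>t\<close> is orthogonal.\<close>

lemma double_coset_surj:
  assumes u: "u \<in> carrier SU4"
  shows "\<exists>t\<in>torus. double_coset u = double_coset t"
proof -
  obtain V d where V: "V \<in> SO4" and d: "unitary (diag_matrix d)"
    and L: "u ** transpose u = V ** diag_matrix d ** transpose V"
    using mult_transpose_mem_sym_unitary[OF u] by (rule symmetric_unitary_SO4_diagonalization)
  have "det (V ** diag_matrix d ** transpose V) = 1"
    using u by (simp add: L[symmetric] det_mul)
  then have "prod d UNIV = 1" using V by (simp add: det_mul SO4_iff)
  then have "diag_matrix d \<in> torus"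
    using d by (auto simp: torus_iff unitary_diag_matrix)
  then obtain t where t: "t \<in> torus" "t ** t = diag_matrix d" by (rule torus_sqrt)
  then have tt: "transpose t = t" by (auto simp: torus_iff)
  have ut: "unitary t" using t torus_subset by auto
  define n where "n = conj_transpose t ** transpose V ** u"
  have "n ** transpose n = conj_transpose t ** transpose V ** (u ** transpose u) ** V ** conj_transpose t"
    by (simp add: n_def matrix_transpose_mul transpose_conj_transpose tt matrix_mul_assoc)
  also have "\<dots> = mat 1"
    unfolding L t(2)[symmetric] by (simp add: SO4_cancel[OF V] unitary_cancel[OF ut] flip: matrix_mul_assoc)
  finally have "n \<in> SO4"
    using u t V torus_subset by (auto simp: SO4_iff n_def unitary_mult det_mul)
  then have "n \<in> N4" using SO4_subset_N4 by blast
  moreover have "u = V ** t ** n"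
    by (simp add: n_def SO4_cancel[OF V] unitary_cancel[OF ut] flip: matrix_mul_assoc)
  ultimately have "u \<in> double_coset t" using V by (auto simp: double_coset_eq)
  then show ?thesis using t(1) double_coset_eq_iff by blast
qed

text \<open>The spectral theorem conjugates \<open>u\<close> into the torus, where squaring is
  surjective. Scaling the diagonalizing matrix to determinant 1 does not disturb the eigenvector
  equation.\<close>

lemma conjugate_to_torus_square:
  assumes u: "u \<in> carrier SU4"
  shows "\<exists>t\<in>torus. \<exists>g\<in>carrier SU4. u = g ** (t ** t) ** conj_transpose g"
proof -
  have "unitary u" using u by simp
  then obtain P d where P: "unitary P" "u ** P = P ** diag_matrix d"
    by (rule unitary_diagonalization)
  obtain c where c: "cmod c = 1" "mat c ** P \<in> carrier SU4"
    using P(1) by (rule unitary_scale_SU4)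
  define g where "g = mat c ** P"
  have g: "unitary g" "det g = 1" using c by (simp_all add: g_def)
  have "u ** g = g ** diag_matrix d"
  proof -
    have "u ** g = mat c ** (u ** P)"
      by (simp only: g_def matrix_mult_mat[of u] matrix_mul_assoc)
    then show ?thesis by (simp only: P(2) g_def matrix_mul_assoc)
  qed
  then have "u ** (g ** conj_transpose g) = g ** diag_matrix d ** conj_transpose g"
    by (simp add: matrix_mul_assoc)
  then have ud: "u = g ** diag_matrix d ** conj_transpose g"
    by (simp add: unitary_cancel[OF g(1)])
  then have "diag_matrix d = conj_transpose g ** u ** g"
    by (simp add: unitary_cancel[OF g(1)] flip: matrix_mul_assoc)
  then have "unitary (diag_matrix d)" "det (diag_matrix d) = 1"
    using g u by (simp_all add: unitary_mult det_mul)
  then have "diag_matrix d \<in> torus" by (auto simp: torus_iff unitary_diag_matrix)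
  then obtain t where "t \<in> torus" "t ** t = diag_matrix d" by (rule torus_sqrt)
  then show ?thesis using ud c(2) unfolding g_def[symmetric] by metis
qed

section \<open>The Weyl group as permutations of the diagonal entries\<close>

lemma normalizer_torus_iff:
  "g \<in> normalizer SU4 torus \<longleftrightarrow> g \<in> carrier SU4 \<and> (\<lambda>t. g ** t ** conj_transpose g) ` torus = torus"
  by (rule normalizer_SU4_iff[OF torus_subset])

text \<open>Having representatives of Weyl group elements inside SO(4) is what lets the Weyl action
  be absorbed into a double coset.\<close>

lemma ex_signed_permutation_normalizer:
  fixes \<pi> :: "4 \<Rightarrow> 4"
  assumes "\<pi> permutes UNIV"
  shows "\<exists>P\<in>SO4. P \<in> normalizer SU4 torus \<and> (\<forall>s. P ** diag_matrix s ** conj_transpose P = diag_matrix (s \<circ> \<pi>))"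
proof -
  obtain P where P: "P \<in> SO4" "\<And>s. P ** diag_matrix s = diag_matrix (s \<circ> \<pi>) ** P"
    using ex_signed_permutation[OF assms] by blast
  have conj: "P ** diag_matrix s ** conj_transpose P = diag_matrix (s \<circ> \<pi>)" for s
    using P(1) by (simp add: P(2) unitary_cancel SO4_iff flip: matrix_mul_assoc)
  have perm: "diag_matrix (s \<circ> p) \<in> torus" if "diag_matrix s \<in> torus" "p permutes UNIV" for s p
    using that prod.permute[OF that(2), of s] by (auto simp: torus_iff)
  have "(\<lambda>t. P ** t ** conj_transpose P) ` torus = torus"
  proof (intro equalityI subsetI)
    fix x assume "x \<in> (\<lambda>t. P ** t ** conj_transpose P) ` torus"
    then obtain t where t: "t \<in> torus" "x = P ** t ** conj_transpose P" by blast
    then obtain s where "t = diag_matrix s" by (auto elim: torusE)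
    then show "x \<in> torus" using perm[OF _ assms] t conj by simp
  next
    fix x assume x: "x \<in> torus"
    then obtain s where s: "x = diag_matrix s" by (auto elim: torusE)
    have "x = P ** diag_matrix (s \<circ> inv_into UNIV \<pi>) ** conj_transpose P"
      using assms by (simp add: conj s comp_assoc permutes_inv_o)
    then show "x \<in> (\<lambda>t. P ** t ** conj_transpose P) ` torus"
      by (rule image_eqI) (use perm x s permutes_inv[OF assms] in simp)
  qed
  then have "P \<in> normalizer SU4 torus"
    using P(1) by (simp add: normalizer_torus_iff SO4_iff)
  then show ?thesis using P(1) conj by (intro bexI[of _ P] conjI allI)
qed

lemma weyl_eq:
  "weyl = {\<lambda>t\<in>torus. g ** t ** conj_transpose g | g. g \<in> normalizer SU4 torus}"
proof -
  have "(\<lambda>t\<in>torus. g \<otimes>\<^bsub>SU4\<^esub> t \<otimes>\<^bsub>SU4\<^esub> inv\<^bsub>SU4\<^esub> g) = (\<lambda>t\<in>torus. g ** t ** conj_transpose g)"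
    if "g \<in> normalizer SU4 torus" for g
    using that inv_SU4[of g] by (simp add: normalizer_torus_iff)
  then show ?thesis unfolding weyl_def by (intro Collect_cong) metis
qed

text \<open>A Weyl element takes \<open>t\<close> to a similar diagonal matrix, so it permutes the
  entries. Replacing \<open>g\<close> by a signed permutation matrix \<open>P\<close> in SO(4) gives
  \<open>P ** t ** (transpose P ** n)\<close>, whose last factor is in N.\<close>

lemma torus_class_subset:
  assumes t: "t \<in> torus"
  shows "torus_class t \<subseteq> torus \<inter> double_coset t"
proof
  fix t' assume "t' \<in> torus_class t"
  then obtain g n where g: "g \<in> normalizer SU4 torus" and n: "n \<in> D4"
    and t': "t' = g ** t ** conj_transpose g ** n"
    using t by (auto simp: torus_class_def weyl_eq)
  have gc: "unitary g" "det g = 1" and gt: "g ** t ** conj_transpose g \<in> torus"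
    using g t normalizer_torus_iff by auto
  obtain d e where de: "t = diag_matrix d" "g ** t ** conj_transpose g = diag_matrix e"
    using t gt by (meson torusE)
  have "g ** diag_matrix d = diag_matrix e ** g"
    unfolding de(2)[symmetric] de(1)[symmetric]
    by (simp add: unitary_cancel[OF gc(1)] flip: matrix_mul_assoc)
  then obtain \<pi> where \<pi>: "\<pi> permutes UNIV" "e = d \<circ> \<pi>"
    using diag_matrix_similar_permutation[of g d e] gc by auto
  then obtain P where P: "P \<in> SO4" "P ** t ** conj_transpose P = diag_matrix e"
    using ex_signed_permutation_normalizer de(1) by blast
  have "t' = P ** t ** (transpose P ** n)"
    unfolding t' de(2) P(2)[symmetric] SO4_conj_transpose[OF P(1)] by (simp add: matrix_mul_assoc)
  moreover have "transpose P ** n \<in> N4"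
    using n P(1) SO4_transpose SO4_subset_N4 by (auto simp: D4_def intro!: N4_mult)
  ultimately have "t' \<in> double_coset t" using P(1) by (auto simp: double_coset_eq)
  moreover have "t' \<in> torus" using t' gt n by (simp add: D4_def torus_mult)
  ultimately show "t' \<in> torus \<inter> double_coset t" by simp
qed

text \<open>Similar diagonal matrices agree up to a permutation. Once a Weyl element has matched the
  entries, the quotient of \<open>t'\<close> by the permuted \<open>t\<close> has square
  \<open>mat z\<close>, hence lies in D. An arbitrary unitary \<open>g\<close> covers both double
  cosets and conjugacy in PSU(4).\<close>

lemma square_conjugate_imp_torus_class:
  assumes t: "t \<in> torus" "t' \<in> torus" and g: "unitary g"
    and eq: "t' ** t' = mat z ** (g ** (t ** t) ** conj_transpose g)"
  shows "t' \<in> torus_class t"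
proof -
  obtain d where d: "t = diag_matrix d" "\<forall>i. cmod (d i) = 1" using t(1) by (rule torusE)
  obtain e where e: "t' = diag_matrix e" using t(2) by (rule torusE)
  have "t' ** t' ** g = mat z ** (g ** (t ** t))"
    unfolding eq by (simp add: unitary_cancel[OF g] flip: matrix_mul_assoc)
  also have "\<dots> = g ** (mat z ** (t ** t))"
    by (simp add: matrix_mul_assoc matrix_mult_mat[of g])
  finally have "g ** diag_matrix (\<lambda>i. z * (d i * d i)) = diag_matrix (\<lambda>i. e i * e i) ** g"
    by (simp add: d e diag_matrix_mult mat_eq_diag_matrix)
  moreover have "det g \<noteq> 0" using cmod_det_unitary[OF g] by auto
  ultimately obtain \<pi> where \<pi>: "\<pi> permutes UNIV"
    and "(\<lambda>i. e i * e i) = (\<lambda>i. z * (d i * d i)) \<circ> \<pi>"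
    using diag_matrix_similar_permutation by blast
  then have ee: "e i * e i = z * (d (\<pi> i) * d (\<pi> i))" for i
    by (simp add: fun_eq_iff)
  obtain P where P: "P \<in> normalizer SU4 torus" "P ** t ** conj_transpose P = diag_matrix (d \<circ> \<pi>)"
    using ex_signed_permutation_normalizer[OF \<pi>] d(1) by blast
  have dc: "d i * cnj (d i) = 1" for i using d(2) mult_cnj_eq_1_iff by blast
  \<comment> \<open>The quotient of \<open>t'\<close> by the permuted \<open>t\<close>; for entries
    of modulus 1 the conjugate is the inverse.\<close>
  define n where "n = diag_matrix (\<lambda>i. cnj (d (\<pi> i)) * e i)"
  have "P ** t ** conj_transpose P \<in> torus" using P(1) t(1) normalizer_torus_iff by blast
  then have "conj_transpose (P ** t ** conj_transpose P) \<in> torus"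
    unfolding P(2) by (auto simp: torus_iff simp flip: cnj_prod)
  then have n: "n \<in> torus"
    using torus_mult[OF _ t(2), of "conj_transpose (P ** t ** conj_transpose P)"]
    by (simp add: P(2) n_def e diag_matrix_mult)
  have "n ** transpose n = mat z"
  proof -
    have "cnj (d (\<pi> i)) * e i * (cnj (d (\<pi> i)) * e i) = z" for i
    proof -
      have "cnj (d (\<pi> i)) * e i * (cnj (d (\<pi> i)) * e i) = cnj (d (\<pi> i)) * cnj (d (\<pi> i)) * (e i * e i)"
        by (simp add: mult_ac)
      also have "\<dots> = z * (d (\<pi> i) * cnj (d (\<pi> i))) * (d (\<pi> i) * cnj (d (\<pi> i)))"
        unfolding ee by (simp add: mult_ac)
      finally show ?thesis by (simp add: dc)
    qed
    then show ?thesis by (simp add: n_def diag_matrix_mult mat_eq_diag_matrix)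
  qed
  then have "n \<in> D4" using n torus_subset by (auto simp: D4_def N4_iff)
  moreover have "t' = P ** t ** conj_transpose P ** n"
    by (simp add: P(2) n_def diag_matrix_mult e dc flip: mult.assoc)
  moreover have "(\<lambda>t\<in>torus. P ** t ** conj_transpose P) \<in> weyl"
    using P(1) weyl_eq by blast
  ultimately show ?thesis
    unfolding torus_class_def using t(1)
    by (intro CollectI exI[of _ "\<lambda>t\<in>torus. P ** t ** conj_transpose P"] exI[of _ n]) simp
qed

text \<open>Torus elements are symmetric, so \<open>t ** transpose t\<close> is the square.
  Comparing determinants makes the scalar a fourth root of unity, that is, central in SU(4), as
  PSU(4) requires.\<close>

lemma double_coset_torus_square:
  assumes t: "t \<in> torus" "t' \<in> torus" and "t' \<in> double_coset t"
  obtains z g where "z ^ 4 = 1" "g \<in> carrier SU4" "t' ** t' = mat z ** (g ** (t ** t) ** conj_transpose g)"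
proof -
  obtain z V where V: "V \<in> SO4" and eq: "t' ** transpose t' = mat z ** (V ** (t ** transpose t) ** transpose V)"
    using assms(3) by (rule mult_transpose_double_coset)
  have tr: "transpose t = t" "transpose t' = t'" using t by (auto simp: torus_iff)
  have "det t = 1" "det t' = 1" "V \<in> carrier SU4" using t torus_subset V SO4_subset by auto
  then have "z ^ 4 = 1"
    using arg_cong[OF eq, of det] by (simp add: det_mul det_mat)
  then show ?thesis
    using that[of z V] V SO4_subset eq unfolding tr SO4_conj_transpose[OF V] by blast
qed

text \<open>A torus element in the double coset has its square conjugate to that of \<open>t\<close>
  up to a scalar, which brings it back into the torus class. So torus classes inherit from double
  cosets that they form a partition.\<close>

lemma torus_class_eq:
  assumes t: "t \<in> torus"
  shows "torus_class t = torus \<inter> double_coset t"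
proof (intro equalityI subsetI)
  fix t' assume t': "t' \<in> torus \<inter> double_coset t"
  then obtain z g where "g \<in> carrier SU4" "t' ** t' = mat z ** (g ** (t ** t) ** conj_transpose g)"
    using double_coset_torus_square[OF t] by blast
  then show "t' \<in> torus_class t"
    using square_conjugate_imp_torus_class[OF t] t' by auto
qed (use torus_class_subset[OF t] in blast)

lemma torus_class_eq_iff_double_coset:
  assumes "t \<in> torus" "t' \<in> torus"
  shows "torus_class t = torus_class t' \<longleftrightarrow> double_coset t = double_coset t'"
  using assms double_coset_self double_coset_eq_iff by (auto simp: torus_class_eq)

section \<open>Conjugacy classes in PSU(4)\<close>

text \<open>A central element commutes with SO(4), hence is scalar, and its determinant is the
  fourth power of the scalar.\<close>

lemma center_SU4_iff: "z \<in> center_SU4 \<longleftrightarrow> (\<exists>c. c ^ 4 = 1 \<and> z = mat c)"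
proof
  assume z: "z \<in> center_SU4"
  then have "z ** V = V ** z" if "V \<in> SO4" for V
    using that SO4_subset by (auto simp: center_SU4_def)
  then obtain c where c: "z = mat c" using commutes_SO4_imp_scalar by blast
  moreover have "det z = 1" using z by (simp add: center_SU4_def)
  ultimately show "\<exists>c. c ^ 4 = 1 \<and> z = mat c" by (auto simp: det_mat)
next
  assume "\<exists>c. c ^ 4 = 1 \<and> z = mat c"
  then obtain c where c: "c ^ 4 = 1" "z = mat c" by blast
  then have "cmod c = 1" using power_eq_1_iff[of c 4] by auto
  moreover have "z ** g = g ** z" for g
    unfolding c(2) by (rule matrix_mult_mat[symmetric])
  ultimately show "z \<in> center_SU4"
    using c by (simp add: center_SU4_def det_mat unitary_mat)
qed

lemma normal_center_SU4: "center_SU4 \<lhd> SU4"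
proof (rule group.normal_invI[OF group_SU4])
  have sub: "center_SU4 \<subseteq> carrier SU4" by (auto simp: center_SU4_def)
  show "subgroup center_SU4 SU4"
  proof (rule group.subgroupI[OF group_SU4 sub])
    show "center_SU4 \<noteq> {}" using center_SU4_iff[of "mat 1"] by auto
    fix a b assume ab: "a \<in> center_SU4" "b \<in> center_SU4"
    then obtain c d where cd: "c ^ 4 = 1" "a = mat c" "d ^ 4 = 1" "b = mat d"
      using center_SU4_iff by blast
    have "a \<otimes>\<^bsub>SU4\<^esub> b = mat (c * d)" "(c * d) ^ 4 = 1"
      using cd by (simp_all add: mat_mult_mat power_mult_distrib)
    then show "a \<otimes>\<^bsub>SU4\<^esub> b \<in> center_SU4" unfolding center_SU4_iff by blast
    have "a \<in> carrier SU4" using ab sub by blast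
    then have "inv\<^bsub>SU4\<^esub> a = mat (cnj c)" "(cnj c) ^ 4 = 1"
      using cd by (simp_all only: inv_SU4 conj_transpose_mat flip: complex_cnj_power) simp_all
    then show "inv\<^bsub>SU4\<^esub> a \<in> center_SU4" unfolding center_SU4_iff by blast
  qed
  fix x h assume x: "x \<in> carrier SU4" and h: "h \<in> center_SU4"
  then obtain c where "h = mat c" using center_SU4_iff by blast
  then have "x \<otimes>\<^bsub>SU4\<^esub> h \<otimes>\<^bsub>SU4\<^esub> inv\<^bsub>SU4\<^esub> x = mat c ** (x ** conj_transpose x)"
    using matrix_mult_mat[of x c] by (simp only: inv_SU4[OF x] SU4_simps(2) matrix_mul_assoc)
  also have "\<dots> = h" using x \<open>h = mat c\<close> by (simp add: unitary_cancel)
  finally show "x \<otimes>\<^bsub>SU4\<^esub> h \<otimes>\<^bsub>SU4\<^esub> inv\<^bsub>SU4\<^esub> x \<in> center_SU4" using h by simp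
qed

section \<open>The projection to PSU(4) and conjugation there\<close>

lemma to_PSU4_eq: "to_PSU4 u = {mat c ** u | c. c ^ 4 = 1}"
proof -
  have eq: "center_SU4 = mat ` {c. c ^ 4 = 1}" by (auto simp: center_SU4_iff)
  show ?thesis unfolding to_PSU4_def r_coset_def eq by auto
qed

lemma to_PSU4_self: "u \<in> to_PSU4 u"
  unfolding to_PSU4_eq by (intro CollectI exI[of _ 1]) simp

lemma to_PSU4_scale:
  assumes "c ^ 4 = 1"
  shows "to_PSU4 (mat c ** u) = to_PSU4 u"
proof -
  \<comment> \<open>One inclusion for all scalars suffices: applied to \<open>inverse c\<close> it
    gives the other.\<close>
  have sub: "to_PSU4 (mat c ** u) \<subseteq> to_PSU4 u" if "c ^ 4 = 1" for c u
  proof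
    fix x assume "x \<in> to_PSU4 (mat c ** u)"
    then obtain d where "d ^ 4 = 1" "x = mat d ** (mat c ** u)" by (auto simp: to_PSU4_eq)
    then have "(d * c) ^ 4 = 1" "x = mat (d * c) ** u"
      using that by (simp_all add: power_mult_distrib matrix_mul_assoc mat_mult_mat)
    then show "x \<in> to_PSU4 u" unfolding to_PSU4_eq by blast
  qed
  have "c \<noteq> 0" using assms by auto
  then have "u = mat (inverse c) ** (mat c ** u)" by (simp add: matrix_mul_assoc mat_mult_mat)
  then have "to_PSU4 u \<subseteq> to_PSU4 (mat c ** u)"
    using sub[of "inverse c" "mat c ** u"] assms by (simp add: power_inverse)
  then show ?thesis using sub[OF assms] by blast
qed

lemma conj_class_eq:
  assumes u: "u \<in> carrier SU4"
  shows "conj_class (to_PSU4 u) = {to_PSU4 (g ** u ** conj_transpose g) | g. g \<in> carrier SU4}"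
proof -
  interpret normal center_SU4 SU4 by (rule normal_center_SU4)
  have carrier: "carrier PSU4 = to_PSU4 ` carrier SU4"
    by (auto simp: PSU4_def FactGroup_def RCOSETS_def to_PSU4_def simp del: SU4_simps)
  have mult: "to_PSU4 g \<otimes>\<^bsub>PSU4\<^esub> to_PSU4 h = to_PSU4 (g ** h)" if "g \<in> carrier SU4" "h \<in> carrier SU4" for g h
    using rcos_sum[OF that] by (simp add: PSU4_def FactGroup_def to_PSU4_def)
  have inv: "inv\<^bsub>PSU4\<^esub> (to_PSU4 g) = to_PSU4 (conj_transpose g)" if "g \<in> carrier SU4" for g
    using inv_FactGroup[of "to_PSU4 g"] rcos_inv[OF that] carrier that
    by (simp add: PSU4_def to_PSU4_def inv_SU4[OF that])
  have "to_PSU4 g \<otimes>\<^bsub>PSU4\<^esub> to_PSU4 u \<otimes>\<^bsub>PSU4\<^esub> inv\<^bsub>PSU4\<^esub> to_PSU4 g = to_PSU4 (g ** u ** conj_transpose g)"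
    if "g \<in> carrier SU4" for g
    using that u SU4_mult[OF that u] SU4_conj_transpose[OF that]
    by (simp only: inv mult)
  then show ?thesis
    unfolding conj_class_def orbit_def carrier by (auto simp del: SU4_simps)
qed

lemma conj_class_self: "u \<in> carrier SU4 \<Longrightarrow> to_PSU4 u \<in> conj_class (to_PSU4 u)"
  unfolding conj_class_eq by (intro CollectI exI[of _ "mat 1"]) (simp add: unitary_mat)

lemma conj_class_conj_mono:
  assumes u: "u \<in> carrier SU4" and g: "g \<in> carrier SU4"
  shows "conj_class (to_PSU4 (g ** u ** conj_transpose g)) \<subseteq> conj_class (to_PSU4 u)"
proof
  fix x assume "x \<in> conj_class (to_PSU4 (g ** u ** conj_transpose g))"
  moreover have "g ** u ** conj_transpose g \<in> carrier SU4"
    using u g by (simp add: unitary_mult det_mul)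
  ultimately obtain h where h: "h \<in> carrier SU4"
    "x = to_PSU4 (h ** (g ** u ** conj_transpose g) ** conj_transpose h)"
    using conj_class_eq by blast
  then have "x = to_PSU4 ((h ** g) ** u ** conj_transpose (h ** g))"
    by (simp add: conj_transpose_mult matrix_mul_assoc)
  then show "x \<in> conj_class (to_PSU4 u)"
    unfolding conj_class_eq[OF u] using SU4_mult[OF h(1) g] by blast
qed

text \<open>The scalar \<open>c\<close> is the ambiguity of lifting from PSU(4) to SU(4). In this
  form the relation is parametrized by the compact set of pairs \<open>(c, g)\<close>.\<close>

lemma conj_class_eq_iff:
  assumes u: "u \<in> carrier SU4" and v: "v \<in> carrier SU4"
  shows "conj_class (to_PSU4 u) = conj_class (to_PSU4 v) \<longleftrightarrow>
    (\<exists>c g. c ^ 4 = 1 \<and> g \<in> carrier SU4 \<and> u = mat c ** (g ** v ** conj_transpose g))"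
proof
  assume "conj_class (to_PSU4 u) = conj_class (to_PSU4 v)"
  then have "to_PSU4 u \<in> conj_class (to_PSU4 v)" using conj_class_self[OF u] by simp
  then obtain g where g: "g \<in> carrier SU4" "to_PSU4 u = to_PSU4 (g ** v ** conj_transpose g)"
    using conj_class_eq[OF v] by blast
  then have "u \<in> to_PSU4 (g ** v ** conj_transpose g)" using to_PSU4_self by blast
  then show "\<exists>c g. c ^ 4 = 1 \<and> g \<in> carrier SU4 \<and> u = mat c ** (g ** v ** conj_transpose g)"
    using g(1) unfolding to_PSU4_eq by blast
next
  assume "\<exists>c g. c ^ 4 = 1 \<and> g \<in> carrier SU4 \<and> u = mat c ** (g ** v ** conj_transpose g)"
  then obtain c g where g: "c ^ 4 = 1" "g \<in> carrier SU4" "u = mat c ** (g ** v ** conj_transpose g)" by blast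
  let ?w = "g ** v ** conj_transpose g"
  have w: "?w \<in> carrier SU4" using v g(2) by (simp add: unitary_mult det_mul)
  have "v = conj_transpose g ** ?w ** conj_transpose (conj_transpose g)"
    using g(2) by (simp add: unitary_cancel flip: matrix_mul_assoc)
  then have "conj_class (to_PSU4 v) \<subseteq> conj_class (to_PSU4 ?w)"
    using conj_class_conj_mono[OF w SU4_conj_transpose[OF g(2)]] by simp
  moreover have "conj_class (to_PSU4 ?w) \<subseteq> conj_class (to_PSU4 v)"
    by (rule conj_class_conj_mono[OF v g(2)])
  moreover have "to_PSU4 u = to_PSU4 ?w" unfolding g(3) by (rule to_PSU4_scale[OF g(1)])
  ultimately show "conj_class (to_PSU4 u) = conj_class (to_PSU4 v)" by simp
qed

text \<open>Forward through double cosets, whose scalar on torus squares is a fourth root of unity;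
  backward directly from the conjugacy of the squares.\<close>

lemma torus_class_eq_iff_conj_class:
  assumes t: "t \<in> torus" "t' \<in> torus"
  shows "torus_class t = torus_class t' \<longleftrightarrow> conj_class (to_PSU4 (t ** t)) = conj_class (to_PSU4 (t' ** t'))"
proof -
  have tt: "t ** t \<in> carrier SU4" "t' ** t' \<in> carrier SU4"
    using t torus_mult torus_subset by blast+
  have "conj_class (to_PSU4 (t ** t)) = conj_class (to_PSU4 (t' ** t'))"
    if "torus_class t = torus_class t'"
  proof -
    have "t \<in> double_coset t'"
      using that torus_class_eq_iff_double_coset[OF t] double_coset_eq_iff by blast
    then obtain z g where "z ^ 4 = 1" "g \<in> carrier SU4" "t ** t = mat z ** (g ** (t' ** t') ** conj_transpose g)"
      by (rule double_coset_torus_square[OF t(2,1)])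
    then show ?thesis using conj_class_eq_iff[OF tt] by blast
  qed
  moreover have "torus_class t = torus_class t'"
    if conj: "conj_class (to_PSU4 (t ** t)) = conj_class (to_PSU4 (t' ** t'))"
  proof -
    obtain z g where "g \<in> carrier SU4" "t ** t = mat z ** (g ** (t' ** t') ** conj_transpose g)"
      using conj conj_class_eq_iff[OF tt] by blast
    then have "t \<in> torus_class t'"
      using square_conjugate_imp_torus_class[OF t(2,1), of g z] by simp
    then show ?thesis
      using torus_class_eq[OF t(2)] torus_class_eq_iff_double_coset[OF t] double_coset_eq_iff by blast
  qed
  ultimately show ?thesis by blast
qed

section \<open>The homeomorphisms\<close>

lemma continuous_on_matrix_mult [continuous_intros]:
  fixes f :: "'a::topological_space \<Rightarrow> 'b::real_normed_algebra_1^'n^'m" and g :: "'a \<Rightarrow> 'b^'k^'n"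
  assumes "continuous_on S f" "continuous_on S g"
  shows "continuous_on S (\<lambda>x. f x ** g x)"
  unfolding matrix_matrix_mult_def using assms by (intro continuous_intros)

lemma continuous_on_transpose [continuous_intros]:
  fixes f :: "'a::topological_space \<Rightarrow> 'b::topological_space^'n^'m"
  assumes "continuous_on S f"
  shows "continuous_on S (\<lambda>x. transpose (f x))"
  unfolding transpose_def using assms by (intro continuous_intros)

lemma continuous_on_conj_transpose [continuous_intros]:
  assumes "continuous_on S f"
  shows "continuous_on S (\<lambda>x. conj_transpose (f x))"
proof -
  have "conj_transpose A = (\<chi> i j. cnj (A $ j $ i))" for A
    by (simp add: vec_eq_iff)
  then show ?thesis using assms by (simp only:) (intro continuous_intros)
qed

lemma continuous_on_mat [continuous_intros]:
  fixes f :: "'a::topological_space \<Rightarrow> 'b::{topological_space, zero}"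
  assumes "continuous_on S f"
  shows "continuous_on S (\<lambda>x. mat (f x) :: 'b^'n^'n)"
proof -
  have "continuous_on S (\<lambda>x. if i = j then f x else 0)" for i j :: 'n
    using assms by (cases "i = j") (auto intro: continuous_intros)
  then show ?thesis unfolding mat_def by (intro continuous_on_vec_lambda)
qed

lemma continuous_on_det [continuous_intros]:
  fixes f :: "'a::topological_space \<Rightarrow> 'b::{real_normed_field}^'n^'n"
  assumes "continuous_on S f"
  shows "continuous_on S (\<lambda>x. det (f x))"
  unfolding det_def using assms by (intro continuous_intros)

text \<open>Closed by its defining equations, bounded because the rows of a unitary matrix are unit
  vectors.\<close>

lemma compact_SU4: "compact (carrier SU4)"
proof -
  have "carrier SU4 = {A. A ** conj_transpose A = mat 1} \<inter> {A. conj_transpose A ** A = mat 1} \<inter> {A. det A = 1}"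
    by (auto simp: unitary_def)
  also have "closed \<dots>"
    by (intro closed_Int closed_Collect_eq continuous_intros)
  finally have "closed (carrier SU4)" .
  moreover have "norm A \<le> 4" if "A \<in> carrier SU4" for A
  proof -
    have "norm (A $ i) = 1" for i
    proof -
      have "(A ** conj_transpose A) $ i $ i = 1" using that by (simp add: unitary_cancel mat_def)
      then have "cinner (A $ i) (A $ i) = 1" by (simp add: cinner_def matrix_matrix_mult_def)
      then have "complex_of_real ((norm (A $ i))\<^sup>2) = 1" unfolding cinner_self .
      then have "(norm (A $ i))\<^sup>2 = 1" unfolding of_real_eq_1_iff .
      then show ?thesis using norm_ge_zero[of "A $ i"] by (auto simp: power2_eq_1_iff)
    qed
    then have "norm A = sqrt 4" by (simp add: norm_vec_def[of A] L2_set_def)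
    then show ?thesis by simp
  qed
  then have "bounded (carrier SU4)" unfolding bounded_iff by blast
  ultimately show ?thesis by (simp only: compact_eq_bounded_closed)
qed

lemma compact_torus: "compact torus"
proof -
  have "torus = carrier SU4 \<inter> (\<Inter>i. \<Inter>j\<in>- {i}. {u. u $ i $ j = 0})"
    by (auto simp: torus_def)
  also have "compact \<dots>"
    by (intro compact_Int_closed compact_SU4 closed_INT ballI closed_Collect_eq continuous_intros)
  finally show ?thesis .
qed

lemma compact_SO4: "compact SO4"
proof -
  have "SO4 = carrier SU4 \<inter> {A. A ** transpose A = mat 1}"
    by (auto simp: SO4_iff)
  also have "compact \<dots>"
    by (intro compact_Int_closed compact_SU4 closed_Collect_eq continuous_intros)
  finally show ?thesis .
qed

lemma compact_N4: "compact N4"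
proof -
  \<comment> \<open>Naming the scalar as a matrix entry turns the existential in
    \<open>N4_iff\<close> into an equation between continuous functions, so the condition is
    closed.\<close>
  have "(\<exists>z. B = mat z) \<longleftrightarrow> B = mat (B $ 0 $ 0)" for B :: "complex^4^4"
  proof
    assume "\<exists>z. B = mat z"
    then obtain z where "B = mat z" ..
    then show "B = mat (B $ 0 $ 0)" by (simp add: mat_def)
  qed blast
  then have "N4 = carrier SU4 \<inter> {A. A ** transpose A = mat ((A ** transpose A) $ 0 $ 0)}"
    by (auto simp: N4_iff)
  also have "compact \<dots>"
    by (intro compact_Int_closed compact_SU4 closed_Collect_eq continuous_intros)
  finally show ?thesis .
qed

lemma compact_U1: "compact {c :: complex. cmod c = 1}"
  using compact_sphere[of "0 :: complex" 1] by (simp add: sphere_def)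

text \<open>The map goes from double cosets to orbits because \<open>u ** transpose u\<close> is the
  continuous map on representatives; its inverse is taken at the end.\<close>

lemma homeomorphic_double_coset_moduli:
  "\<exists>h. homeomorphic_map double_coset_space moduli_space h \<and>
     (\<forall>u\<in>carrier SU4. h (double_coset u) = moduli_class (u ** transpose u))"
  unfolding double_coset_space_def SU4_top_def moduli_space_def
proof (rule homeomorphic_quotient_topologies[where K = "{c. cmod c = 1} \<times> SO4"
      and a = "\<lambda>(c, V) L. mat (c\<^sup>2) ** (V ** L ** transpose V)"])
  show "continuous_on (({c. cmod c = 1} \<times> SO4) \<times> sym_unitary)
      (\<lambda>(k, L). (case k of (c, V) \<Rightarrow> \<lambda>L. mat (c\<^sup>2) ** (V ** L ** transpose V)) L)"
    by (simp add: case_prod_unfold) (intro continuous_intros)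
  show "moduli_class L = moduli_class L' \<longleftrightarrow>
      (\<exists>k\<in>{c. cmod c = 1} \<times> SO4. L = (case k of (c, V) \<Rightarrow> \<lambda>L. mat (c\<^sup>2) ** (V ** L ** transpose V)) L')"
    for L L'
    unfolding moduli_class_eq_iff unfolding moduli_class_eq by auto
qed (use double_coset_iff_moduli_class moduli_class_surj mult_transpose_mem_sym_unitary in
    \<open>auto intro!: compact_SU4 compact_Times compact_U1 compact_SO4 continuous_intros simp del: SU4_simps\<close>)

lemma homeomorphic_torus_double_coset:
  "\<exists>h. homeomorphic_map torus_quotient double_coset_space h \<and> (\<forall>t\<in>torus. h (torus_class t) = double_coset t)"
  unfolding double_coset_space_def SU4_top_def torus_quotient_def
proof (rule homeomorphic_quotient_topologies[where K = "SO4 \<times> N4" and f = "\<lambda>t. t"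
      and a = "\<lambda>(V, n) u. V ** u ** n"])
  show "continuous_on ((SO4 \<times> N4) \<times> carrier SU4) (\<lambda>(k, u). (case k of (V, n) \<Rightarrow> \<lambda>u. V ** u ** n) u)"
    by (simp add: case_prod_unfold) (intro continuous_intros)
  show "double_coset u = double_coset v \<longleftrightarrow> (\<exists>k\<in>SO4 \<times> N4. u = (case k of (V, n) \<Rightarrow> \<lambda>u. V ** u ** n) v)" for u v
    unfolding double_coset_eq_iff unfolding double_coset_eq by auto
qed (use torus_class_eq_iff_double_coset double_coset_surj torus_subset in
    \<open>auto intro!: compact_torus compact_Times compact_N4 compact_SO4 continuous_intros simp del: SU4_simps\<close>)

lemma homeomorphic_torus_conj_class:
  "\<exists>h. homeomorphic_map torus_quotient conj_class_space h \<and>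
     (\<forall>t\<in>torus. h (torus_class t) = conj_class (to_PSU4 (t ** t)))"
proof -
  \<comment> \<open>Conjugacy in PSU(4) is parametrized by the finite group of fourth roots of unity
    times SU(4), hence by a compact set.\<close>
  have "finite {c :: complex. c ^ 4 = 1}"
    by (rule finite_roots_unity) simp
  then have comp: "compact ({c :: complex. c ^ 4 = 1} \<times> carrier SU4)"
    by (intro compact_Times finite_imp_compact compact_SU4)
  have "\<exists>h. homeomorphic_map (quotient_topology (top_of_set torus) torus_class)
        (quotient_topology (top_of_set (carrier SU4)) (conj_class \<circ> to_PSU4)) h \<and>
      (\<forall>t\<in>torus. h (torus_class t) = (conj_class \<circ> to_PSU4) (t ** t))"
  proof (rule homeomorphic_quotient_topologies[OF compact_torus comp,
        where a = "\<lambda>(c, g) u. mat c ** (g ** u ** conj_transpose g)"])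
    show "continuous_on (({c. c ^ 4 = 1} \<times> carrier SU4) \<times> carrier SU4)
        (\<lambda>(k, u). (case k of (c, g) \<Rightarrow> \<lambda>u. mat c ** (g ** u ** conj_transpose g)) u)"
      by (simp add: case_prod_unfold del: SU4_simps) (intro continuous_intros)
    show "continuous_on torus (\<lambda>t. t ** t)"
      by (intro continuous_intros)
    show "(\<lambda>t. t ** t) ` torus \<subseteq> carrier SU4"
      using torus_mult torus_subset by blast
    show "torus_class t = torus_class t' \<longleftrightarrow> (conj_class \<circ> to_PSU4) (t ** t) = (conj_class \<circ> to_PSU4) (t' ** t')"
      if "t \<in> torus" "t' \<in> torus" for t t'
      using torus_class_eq_iff_conj_class[OF that] by simp
    show "(conj_class \<circ> to_PSU4) u = (conj_class \<circ> to_PSU4) v \<longleftrightarrow>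
        (\<exists>k\<in>{c. c ^ 4 = 1} \<times> carrier SU4. u = (case k of (c, g) \<Rightarrow> \<lambda>u. mat c ** (g ** u ** conj_transpose g)) v)"
      if "u \<in> carrier SU4" "v \<in> carrier SU4" for u v
      using conj_class_eq_iff[OF that] by (auto simp del: SU4_simps)
    show "\<exists>t\<in>torus. (conj_class \<circ> to_PSU4) u = (conj_class \<circ> to_PSU4) (t ** t)" if u: "u \<in> carrier SU4" for u
    proof -
      obtain t g where t: "t \<in> torus" "g \<in> carrier SU4" "u = g ** (t ** t) ** conj_transpose g"
        using conjugate_to_torus_square[OF u] by blast
      have "t ** t \<in> carrier SU4" using t(1) torus_mult torus_subset by blast
      moreover have "u = mat 1 ** (g ** (t ** t) ** conj_transpose g)" using t(3) by simp
      ultimately have "conj_class (to_PSU4 u) = conj_class (to_PSU4 (t ** t))"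
        using conj_class_eq_iff[OF u] t(2) power_one by blast
      then show ?thesis using t(1) by auto
    qed
  qed
  then show ?thesis
    by (simp add: torus_quotient_def conj_class_space_def PSU4_top_def SU4_top_def quotient_topology_quotient_topology)
qed

text \<open>\<open>\<iota>\<close> is induced by the inclusion of the torus, so
  \<open>\<iota> (\<Psi> m) = \<Phi> m\<close> is what it means that \<open>\<Phi>\<close> restricts
  to \<open>\<Psi>\<close>. The values of \<open>\<Phi>\<close> pin it down, since each orbit
  contains some \<open>u ** transpose u\<close>.\<close>

theorem proposition3p1:
  shows "\<exists>\<Phi> \<Psi> \<iota> \<Theta>.
     homeomorphic_map moduli_space double_coset_space \<Phi> \<and>
     (\<forall>u \<in> carrier SU4. u ** transpose u \<in> sym_unitary \<and>
        \<Phi> (moduli_class (u ** transpose u)) = double_coset u) \<and>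
     homeomorphic_map torus_quotient double_coset_space \<iota> \<and>
     (\<forall>t \<in> torus. \<iota> (torus_class t) = double_coset t) \<and>
     homeomorphic_map moduli_space torus_quotient \<Psi> \<and>
     (\<forall>m \<in> topspace moduli_space. \<iota> (\<Psi> m) = \<Phi> m) \<and>
     homeomorphic_map torus_quotient conj_class_space \<Theta> \<and>
     (\<forall>t \<in> torus. t ** t \<in> torus \<and>
        \<Theta> (torus_class t) = conj_class (to_PSU4 (t ** t))) \<and>
     homeomorphic_map moduli_space conj_class_space (\<Theta> \<circ> \<Psi>)"
proof -
  obtain \<phi> where \<phi>: "homeomorphic_map double_coset_space moduli_space \<phi>"
    "\<And>u. u \<in> carrier SU4 \<Longrightarrow> \<phi> (double_coset u) = moduli_class (u ** transpose u)"
    using homeomorphic_double_coset_moduli by blast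
  obtain \<iota> where \<iota>: "homeomorphic_map torus_quotient double_coset_space \<iota>"
    "\<And>t. t \<in> torus \<Longrightarrow> \<iota> (torus_class t) = double_coset t"
    using homeomorphic_torus_double_coset by blast
  obtain \<Theta> where \<Theta>: "homeomorphic_map torus_quotient conj_class_space \<Theta>"
    "\<And>t. t \<in> torus \<Longrightarrow> \<Theta> (torus_class t) = conj_class (to_PSU4 (t ** t))"
    using homeomorphic_torus_conj_class by blast
  \<comment> \<open>Both maps are inverted: \<open>\<Phi>\<close> undoes \<open>\<phi>\<close> and
    \<open>\<kappa>\<close> undoes \<open>\<iota>\<close>, so \<open>\<kappa> \<circ> \<Phi>\<close>
    serves as \<open>\<Psi>\<close>.\<close>
  obtain \<Phi> where \<Phi>: "homeomorphic_maps double_coset_space moduli_space \<phi> \<Phi>"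
    using \<phi>(1) homeomorphic_map_maps by blast
  obtain \<kappa> where \<kappa>: "homeomorphic_maps torus_quotient double_coset_space \<iota> \<kappa>"
    using \<iota>(1) homeomorphic_map_maps by blast
  have h\<Phi>: "homeomorphic_map moduli_space double_coset_space \<Phi>"
    and h\<kappa>: "homeomorphic_map double_coset_space torus_quotient \<kappa>"
    using \<Phi> \<kappa> homeomorphic_maps_map by blast+
  have "\<Phi> (moduli_class (u ** transpose u)) = double_coset u" if u: "u \<in> carrier SU4" for u
  proof -
    have "double_coset u \<in> topspace double_coset_space"
      using u by (simp add: double_coset_space_def topspace_quotient_topology SU4_top_def del: SU4_simps)
    then show ?thesis
      using \<Phi> unfolding \<phi>(2)[OF u, symmetric] homeomorphic_maps_def by blast
  qed
  moreover have "\<iota> ((\<kappa> \<circ> \<Phi>) m) = \<Phi> m" if "m \<in> topspace moduli_space" for m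
  proof -
    have "\<Phi> m \<in> topspace double_coset_space"
      using that h\<Phi> homeomorphic_imp_surjective_map by blast
    then show ?thesis using \<kappa> by (simp add: homeomorphic_maps_def)
  qed
  moreover have h\<Psi>: "homeomorphic_map moduli_space torus_quotient (\<kappa> \<circ> \<Phi>)"
    using h\<Phi> h\<kappa> by (rule homeomorphic_map_compose)
  moreover have "homeomorphic_map moduli_space conj_class_space (\<Theta> \<circ> (\<kappa> \<circ> \<Phi>))"
    using h\<Psi> \<Theta>(1) by (rule homeomorphic_map_compose)
  ultimately show ?thesis
    using h\<Phi> \<iota> \<Theta> mult_transpose_mem_sym_unitary torus_mult
    by (intro exI[of _ \<Phi>] exI[of _ "\<kappa> \<circ> \<Phi>"] exI[of _ \<iota>] exI[of _ \<Theta>] conjI ballI)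
      (simp_all del: SU4_simps)
qed

end
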